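(* Let $G$ be a finite group, and write $I = \operatorname{IrPt}$ and $C = \operatorname{ClPt}$. (a) Let $\mathcal{K}$ be a $G$-invariant partition of $G$. Choose $n$ such that $(CI)^{n+1}(\mathcal{K}) = (CI)^n(\mathcal{K})$. Then $\big( I(CI)^n(\mathcal{K}), (CI)^n(\mathcal{K}) \big)$ is the coarsest supercharacter theory of $G$ whose class partition refines $\mathcal{K}$. (b) Let $\mathcal{X}$ be a partition of $\operatorname{Irr} G$. Choose $n$ such that $(IC)^{n+1}(\mathcal{X}) = (IC)^n(\mathcal{X})$. Then $\big( (IC)^n(\mathcal{X}), C(IC)^n(\mathcal{X}) \big)$ is the coarsest supercharacter theory of $G$ whose character partition refines $\mathcal{X}$.
   Context: $\operatorname{Irr} G$ is the set of irreducible complex characters of the finite group $G$. For $X \subseteq \operatorname{Irr} G$ put $\sigma_X = \sum_{\chi \in X} \chi(1)\chi$. For $K \subseteq G$ put $\hat{K} = \sum_{g \in K} g \in \mathbb{C}G$; characters are extended linearly to $\mathbb{C}G$. A subset of $G$ is $G$-invariant if it is a union of conjugacy classes; a partition of $G$ is $G$-invariant if all its members are. A partition $\mathcal{K}$ refines (is finer than, written $\mathcal{K} \preceq \mathcal{L}$) a partition $\mathcal{L}$ of the same set if every block of $\mathcal{K}$ is contained in a block of $\mathcal{L}$ (equality allowed); then $\mathcal{L}$ is coarser than $\mathcal{K}$. Supercharacter theory: a pair $(\mathcal{X},\mathcal{K})$ with $\mathcal{X}$ a partition of $\operatorname{Irr} G$ (its character partition) and $\mathcal{K}$ a partition of $G$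 (its class partition) such that $|\mathcal{X}| = |\mathcal{K}|$ and, for every $X \in \mathcal{X}$, the character $\sigma_X$ is constant on each member of $\mathcal{K}$. A supercharacter theory $(\mathcal{Y},\mathcal{L})$ is coarser than $(\mathcal{X},\mathcal{K})$ if $\mathcal{X} \preceq \mathcal{Y}$ (for supercharacter theories this is equivalent to $\mathcal{K} \preceq \mathcal{L}$). "The coarsest" with a property means the one that has the property and is coarser than every other one with the property. For a collection $\mathcal{X}$ of subsets of $\operatorname{Irr} G$, $\operatorname{ClPt}(\mathcal{X})$ is the partition of $G$ into equivalence classes of the relation: $g \sim h$ if and only if $\sigma_X(g) = \sigma_X(h)$ for all $X \in \mathcal{X}$. For a collection $\mathcal{K}$ of $G$-invariant subsets of $G$, $\operatorname{IrPt}(\mathcal{K})$ is the partition of $\operatorname{Irr} G$ into equivalence classes of the relation: $\chi \sim \psi$ if and only if $\chi(\hat{K})/\chi(1) = \psi(\hat{K})/\psi(1)$ for all $K \in \mathcal{K}$. Juxtaposition denotes composition of maps, e.g. $CI(\mathcal{K}) = \operatorname{ClPt}(\operatorname{IrPt}(\mathcal{K}))$; $n\geq 0$ is an integer. *)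

theory Defs
  imports
    "HOL-Algebra.Group_Action"
    "HOL-Library.Disjoint_Sets"
    "HOL-Library.Poly_Mapping"
    "Jordan_Normal_Form.VS_Connect"
begin

subsection \<open>Irreducible complex characters\<close>

definition representation :: "('a, 'b) monoid_scheme \<Rightarrow> nat \<Rightarrow> ('a \<Rightarrow> complex mat) \<Rightarrow> bool" where
  "representation G n \<rho> \<longleftrightarrow> \<rho> \<in> hom G (units_of (ring_mat TYPE(complex) n ()))"

definition irreducible_representation ::
    "('a, 'b) monoid_scheme \<Rightarrow> nat \<Rightarrow> ('a \<Rightarrow> complex mat) \<Rightarrow> bool" where
  "irreducible_representation G n \<rho> \<longleftrightarrow>
     representation G n \<rho> \<and> n > 0 \<and>
     (\<forall>W. VectorSpace.subspace class_ring W (module_vec TYPE(complex) n) \<and>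
          (\<forall>g\<in>carrier G. \<forall>w\<in>W. \<rho> g *\<^sub>v w \<in> W)
          \<longrightarrow> W = {0\<^sub>v n} \<or> W = carrier_vec n)"

definition mat_trace :: "'c::comm_monoid_add mat \<Rightarrow> 'c" where
  "mat_trace A = (\<Sum>i<dim_row A. A $$ (i, i))"

text \<open>Characters are made extensional outside \<open>carrier G\<close>, so that two of them are equal
  iff they agree on \<open>carrier G\<close>.\<close>

definition character_of :: "('a, 'b) monoid_scheme \<Rightarrow> ('a \<Rightarrow> complex mat) \<Rightarrow> 'a \<Rightarrow> complex" where
  "character_of G \<rho> = (\<lambda>g\<in>carrier G. mat_trace (\<rho> g))"

definition Irr :: "('a, 'b) monoid_scheme \<Rightarrow> ('a \<Rightarrow> complex) set" where
  "Irr G = {character_of G \<rho> | n \<rho>. irreducible_representation G n \<rho>}"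

definition sigma :: "('a, 'b) monoid_scheme \<Rightarrow> ('a \<Rightarrow> complex) set \<Rightarrow> 'a \<Rightarrow> complex" where
  "sigma G X g = (\<Sum>\<chi>\<in>X. \<chi> \<one>\<^bsub>G\<^esub> * \<chi> g)"

subsection \<open>The group algebra\<close>

text \<open>An element of the group algebra is a finitely supported coefficient function on \<open>G\<close>.\<close>

definition set_sum :: "'a set \<Rightarrow> ('a \<Rightarrow>\<^sub>0 complex)" where
  "set_sum K = (\<Sum>g\<in>K. Poly_Mapping.single g 1)"

definition linear_ext :: "('a \<Rightarrow> complex) \<Rightarrow> ('a \<Rightarrow>\<^sub>0 complex) \<Rightarrow> complex" where
  "linear_ext \<chi> a = (\<Sum>g\<in>Poly_Mapping.keys a. Poly_Mapping.lookup a g * \<chi> g)"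

subsection \<open>Invariant sets and the two partitions\<close>

definition conj_classes :: "('a, 'b) monoid_scheme \<Rightarrow> 'a set set" where
  "conj_classes G = orbits G (carrier G) (\<lambda>g. \<lambda>h \<in> carrier G. g \<otimes>\<^bsub>G\<^esub> h \<otimes>\<^bsub>G\<^esub> inv\<^bsub>G\<^esub> g)"

definition G_invariant :: "('a, 'b) monoid_scheme \<Rightarrow> 'a set \<Rightarrow> bool" where
  "G_invariant G K \<longleftrightarrow> (\<exists>S \<subseteq> conj_classes G. K = \<Union>S)"

definition ClPt :: "('a, 'b) monoid_scheme \<Rightarrow> ('a \<Rightarrow> complex) set set \<Rightarrow> 'a set set" where
  "ClPt G \<X> = carrier G //
     {(g, h). g \<in> carrier G \<and> h \<in> carrier G \<and> (\<forall>X\<in>\<X>. sigma G X g = sigma G X h)}"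

definition IrPt :: "('a, 'b) monoid_scheme \<Rightarrow> 'a set set \<Rightarrow> ('a \<Rightarrow> complex) set set" where
  "IrPt G \<K> = Irr G //
     {(\<chi>, \<psi>). \<chi> \<in> Irr G \<and> \<psi> \<in> Irr G \<and>
        (\<forall>K\<in>\<K>. linear_ext \<chi> (set_sum K) / \<chi> \<one>\<^bsub>G\<^esub> = linear_ext \<psi> (set_sum K) / \<psi> \<one>\<^bsub>G\<^esub>)}"

subsection \<open>Supercharacter theories\<close>

definition supercharacter_theory ::
    "('a, 'b) monoid_scheme \<Rightarrow> ('a \<Rightarrow> complex) set set \<times> 'a set set \<Rightarrow> bool" where
  "supercharacter_theory G = (\<lambda>(\<X>, \<K>).
     partition_on (Irr G) \<X> \<and> partition_on (carrier G) \<K> \<and> card \<X> = card \<K> \<and>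
     (\<forall>X\<in>\<X>. \<forall>K\<in>\<K>. \<forall>g\<in>K. \<forall>h\<in>K. sigma G X g = sigma G X h))"

definition coarser ::
    "('a, 'b) monoid_scheme \<Rightarrow> ('a \<Rightarrow> complex) set set \<times> 'a set set
       \<Rightarrow> ('a \<Rightarrow> complex) set set \<times> 'a set set \<Rightarrow> bool" where
  "coarser G T S \<longleftrightarrow> refines (Irr G) (fst S) (fst T)"

definition coarser_than_all_others ::
    "('a, 'b) monoid_scheme \<Rightarrow> (('a \<Rightarrow> complex) set set \<times> 'a set set \<Rightarrow> bool)
       \<Rightarrow> ('a \<Rightarrow> complex) set set \<times> 'a set set \<Rightarrow> bool" where
  "coarser_than_all_others G P T \<longleftrightarrow>
     supercharacter_theory G T \<and> P T \<and>
     (\<forall>S. supercharacter_theory G S \<and> P S \<and> S \<noteq> T \<longrightarrow> coarser G T S)"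

text \<open>\<^const>\<open>coarser\<close> compares character partitions only, so that uniqueness of the
  coarsest theory is not a formal consequence of antisymmetry and is stated explicitly.\<close>

definition is_the_coarsest ::
    "('a, 'b) monoid_scheme \<Rightarrow> (('a \<Rightarrow> complex) set set \<times> 'a set set \<Rightarrow> bool)
       \<Rightarrow> ('a \<Rightarrow> complex) set set \<times> 'a set set \<Rightarrow> bool" where
  "is_the_coarsest G P T \<longleftrightarrow>
     coarser_than_all_others G P T \<and> (\<forall>S. coarser_than_all_others G P S \<longrightarrow> S = T)"

end

theory Submission
  imports Defs "Jordan_Normal_Form.Spectral_Radius"
begin

text \<open>
For an irreducible character \<open>\<chi>\<close> and a set \<open>K\<close> of group elements let \<open>\<omega> K \<chi>\<close> be the value of
\<open>\<chi>/\<chi>(1)\<close> on the sum of \<open>K\<close>, and write \<open>I\<close> and \<open>C\<close> for \<^const>\<open>IrPt\<close> and \<^const>\<open>ClPt\<close>. Everything rests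
on two inversion formulas.
  \<^item> If \<open>\<sigma>\<^sub>X\<close> is constant on the blocks \<open>L\<close> of a partition of \<open>G\<close>, then the sum over \<open>L\<close> of
    \<open>\<omega> L \<chi> \<cdot> cnj (\<sigma>\<^sub>X(L)) / |G|\<close> is \<open>1\<close> for \<open>\<chi> \<in> X\<close> and \<open>0\<close> otherwise
    (\<open>class_partition_inversion\<close>, which is row orthogonality).
  \<^item> If \<open>K\<close> is \<open>G\<close>-invariant and \<open>\<omega> K\<close> is constant on the blocks \<open>X\<close> of a partition of \<open>Irr G\<close>, then
    the sum over \<open>X\<close> of \<open>cnj (\<sigma>\<^sub>X(g)) / |G| \<cdot> \<omega> K X\<close> is \<open>1\<close> for \<open>g \<in> K\<close> and \<open>0\<close> otherwise
    (\<open>character_partition_inversion\<close>, which is column orthogonality).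

The formulas recover the indicator function of \<open>X\<close> from the functions \<open>\<omega> L\<close>, and that of \<open>K\<close> from
the functions \<open>\<sigma>\<^sub>X\<close>. Hence \<open>I (C \<X>)\<close> refines \<open>\<X>\<close>, and \<open>C (I \<K>)\<close> refines an invariant partition \<open>\<K>\<close>.
Both iterations therefore descend among the partitions of a finite set and become stationary.

At a stationary point \<open>(\<X>, \<K>)\<close> both formulas apply. They say that the matrix with entries
\<open>\<omega> K X\<close> and the matrix with entries \<open>cnj (\<sigma>\<^sub>X(K)) / |G|\<close> are inverse to each other, so comparing
the traces of their two products gives \<open>|\<X>| = |\<K>|\<close>, and \<open>(\<X>, \<K>)\<close> is a supercharacter theory.

Conversely every supercharacter theory \<open>(\<Y>, \<L>)\<close> satisfies \<open>C \<Y> = \<L>\<close> and \<open>I \<L> = \<Y>\<close>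
(\<open>supercharacter_theory_determined\<close>). The first formula gives \<open>|\<Y>| \<le> |C \<Y>|\<close>, while \<open>\<L>\<close> refines
\<open>C \<Y>\<close> and \<open>|\<Y>| = |\<L>|\<close>, so \<open>C \<Y> = \<L>\<close>; the one-sided inverse of the first formula, now being square,
is two-sided, and this forces \<open>\<omega> L\<close> to be constant on the blocks of \<open>\<Y>\<close>. Since \<open>I\<close> and \<open>C\<close> are
monotone with respect to refinement, a theory that refines the initial partition refines all its
iterates, in particular the stationary one.

The orthogonality relations are derived from Schur's lemma by averaging over the group. For the
second one, every character is a sum of irreducible characters, by induction along invariant
subspaces and the corresponding quotients. Applied to the
regular representation this shows that \<open>Irr G\<close> is finite and that the sum of \<open>\<chi>(1)\<chi>\<close> is the regular
character, and column orthogonality follows because \<open>\<chi>(h)\<chi>(g)/\<chi>(1)\<close> is the mean of \<open>\<chi>\<close> over the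
products of \<open>h\<close> with the conjugates of \<open>g\<close>.
\<close>

section \<open>Linear algebra\<close>

text \<open>Padding both factors with zeros to square matrices turns the left inverse into a two-sided one,
but the other product has a zero row.\<close>

lemma left_inverse_dim_le:
  fixes C :: "'f::field mat"
  assumes C: "C \<in> carrier_mat r n" and B: "B \<in> carrier_mat n r" and CB: "C * B = 1\<^sub>m r"
  shows "r \<le> n"
proof (rule ccontr)
  assume "\<not> r \<le> n"
  then have nr: "n < r" by simp
  \<comment> \<open>The padded factors still multiply to the identity matrix.\<close>
  define C' where "C' = mat r r (\<lambda>(i, j). if j < n then C $$ (i, j) else 0)"
  define B' where "B' = mat r r (\<lambda>(i, j). if i < n then B $$ (i, j) else 0)"
  have C': "C' \<in> carrier_mat r r" and B': "B' \<in> carrier_mat r r" by (auto simp: C'_def B'_def)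
  have "C' * B' = C * B"
  proof (rule eq_matI)
    fix i j assume "i < dim_row (C * B)" "j < dim_col (C * B)"
    then have ij: "i < r" "j < r" using C B by auto
    have "(C' * B') $$ (i, j) = (\<Sum>k<r. if k < n then C $$ (i, k) * B $$ (k, j) else 0)"
      using ij C' B' by (auto simp: scalar_prod_def C'_def B'_def atLeast0LessThan intro!: sum.cong)
    also have "\<dots> = (\<Sum>k<n. C $$ (i, k) * B $$ (k, j))"
      using nr by (intro sum.mono_neutral_cong_right) auto
    also have "\<dots> = (C * B) $$ (i, j)"
      using ij C B by (auto simp: scalar_prod_def atLeast0LessThan intro!: sum.cong)
    finally show "(C' * B') $$ (i, j) = (C * B) $$ (i, j)" .
  qed (use C B C' B' in auto)
  then have "B' * C' = 1\<^sub>m r"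
    using mat_mult_left_right_inverse[OF C' B'] CB by simp
  then have "(B' * C') $$ (n, n) = 1" using nr by simp
  moreover have "(B' * C') $$ (n, n) = 0"
    using nr B' C' by (auto simp: scalar_prod_def B'_def intro!: sum.neutral)
  ultimately show False by simp
qed

lemma mat_trace_mult_comm:
  fixes A :: "'f::comm_semiring_0 mat"
  assumes "A \<in> carrier_mat n m" "B \<in> carrier_mat m n"
  shows "mat_trace (A * B) = mat_trace (B * A)"
proof -
  have "mat_trace (A * B) = (\<Sum>i<n. \<Sum>k<m. A $$ (i, k) * B $$ (k, i))"
    using assms by (auto simp: mat_trace_def scalar_prod_def atLeast0LessThan intro!: sum.cong)
  also have "\<dots> = (\<Sum>k<m. \<Sum>i<n. B $$ (k, i) * A $$ (i, k))"
    by (subst sum.swap) (simp add: mult.commute)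
  also have "\<dots> = mat_trace (B * A)"
    using assms by (auto simp: mat_trace_def scalar_prod_def atLeast0LessThan intro!: sum.cong)
  finally show ?thesis .
qed

lemma mat_trace_add:
  "A \<in> carrier_mat n n \<Longrightarrow> B \<in> carrier_mat n n \<Longrightarrow> mat_trace (A + B) = mat_trace A + mat_trace B"
  by (auto simp: mat_trace_def sum.distrib)

lemma mat_trace_smult: "(A :: 'f::semiring_0 mat) \<in> carrier_mat n n \<Longrightarrow> mat_trace (c \<cdot>\<^sub>m A) = c * mat_trace A"
  by (auto simp: mat_trace_def sum_distrib_left)

lemma mat_trace_one [simp]: "mat_trace (1\<^sub>m n) = (of_nat n :: complex)"
  by (simp add: mat_trace_def)

lemma subspace_vec_iff:
  "VectorSpace.subspace class_ring W (module_vec TYPE('f::field) n) \<longleftrightarrow>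
     W \<subseteq> carrier_vec n \<and> 0\<^sub>v n \<in> W \<and> (\<forall>v\<in>W. \<forall>w\<in>W. v + w \<in> W) \<and> (\<forall>c. \<forall>v\<in>W. c \<cdot>\<^sub>v v \<in> W)"
  using vec_vs[where ?'a = 'f, of n] vec_module[where ?'a = 'f, of n]
  by (auto simp: VectorSpace.subspace_def submodule_def module_vec_simps class_ring_simps)

lemma subspace_mult_mat_vec:
  fixes B :: "'f::field mat"
  assumes W: "VectorSpace.subspace class_ring W (module_vec TYPE('f) n)"
    and B: "B \<in> carrier_mat n r" and cols: "\<And>j. j < r \<Longrightarrow> col B j \<in> W"
    and v: "v \<in> carrier_vec r"
  shows "B *\<^sub>v v \<in> W"
proof -
  have "m \<le> r \<Longrightarrow> vec n (\<lambda>i. \<Sum>j<m. B $$ (i, j) * v $ j) \<in> W" for m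
  proof (induction m)
    case 0
    have "vec n (\<lambda>i. \<Sum>j<0. B $$ (i, j) * v $ j) = 0\<^sub>v n" by auto
    then show ?case using W by (simp add: subspace_vec_iff)
  next
    case (Suc m)
    have "vec n (\<lambda>i. \<Sum>j<Suc m. B $$ (i, j) * v $ j)
        = vec n (\<lambda>i. \<Sum>j<m. B $$ (i, j) * v $ j) + v $ m \<cdot>\<^sub>v col B m"
      using Suc.prems B by (auto intro!: eq_vecI simp: mult.commute)
    then show ?case using W Suc cols[of m] by (simp add: subspace_vec_iff)
  qed
  from this[of r] have "vec n (\<lambda>i. \<Sum>j<r. B $$ (i, j) * v $ j) \<in> W" by simp
  also have "vec n (\<lambda>i. \<Sum>j<r. B $$ (i, j) * v $ j) = B *\<^sub>v v"
    using B v by (auto intro!: eq_vecI sum.cong simp: scalar_prod_def atLeast0LessThan)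
  finally show ?thesis .
qed

text \<open>The inductive step in the construction of a basis of a subspace together with dual coordinate
functionals: the columns of \<open>B\<close> are the vectors found so far, the rows of \<open>C\<close> the functionals. The
vector \<open>u\<close> is annihilated by the functionals, and the functional dual to it is a coordinate
at which \<open>u\<close> does not vanish, corrected by \<open>B * C\<close> so that it kills the columns of \<open>B\<close>.\<close>

lemma subspace_projection_extend:
  fixes B :: "'f::field mat"
  assumes B: "B \<in> carrier_mat n r" and C: "C \<in> carrier_mat r n" and CB: "C * B = 1\<^sub>m r"
    and u: "u \<in> carrier_vec n" "u \<noteq> 0\<^sub>v n" and Cu: "C *\<^sub>v u = 0\<^sub>v r"
  shows "\<exists>C'\<in>carrier_mat (Suc r) n. C' * mat_of_cols n (cols B @ [u]) = 1\<^sub>m (Suc r)"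
proof -
  obtain i where i: "i < n" "u $ i \<noteq> 0"
    using u by (metis carrier_vecD eq_vecI index_zero_vec)
  define c where "c = (1 / u $ i) \<cdot>\<^sub>v (unit_vec n i - row (B * C) i)"
  have BC: "B * C \<in> carrier_mat n n" using B C by simp
  have c: "c \<in> carrier_vec n" using BC i by (auto simp: c_def)
  have cv: "c \<bullet> v = (1 / u $ i) * (v $ i - (B *\<^sub>v (C *\<^sub>v v)) $ i)" if v: "v \<in> carrier_vec n" for v
  proof -
    have "c \<bullet> v = (1 / u $ i) * ((unit_vec n i - row (B * C) i) \<bullet> v)"
      unfolding c_def using BC i v by (subst smult_scalar_prod_distrib[of _ n]) auto
    also have "(unit_vec n i - row (B * C) i) \<bullet> v = unit_vec n i \<bullet> v - row (B * C) i \<bullet> v"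
      using BC i v by (intro minus_scalar_prod_distrib[of _ n]) auto
    also have "row (B * C) i \<bullet> v = ((B * C) *\<^sub>v v) $ i" using BC i by auto
    also have "(B * C) *\<^sub>v v = B *\<^sub>v (C *\<^sub>v v)" by (rule assoc_mult_mat_vec[OF B C v])
    finally show ?thesis using i v by simp
  qed
  define C' where "C' = mat_of_rows n (rows C @ [c])"
  have C': "C' \<in> carrier_mat (Suc r) n" using C by (auto simp: C'_def intro: carrier_matI)
  have rowC': "row C' k = (if k < r then row C k else c)" if "k < Suc r" for k
    using that C c unfolding C'_def by (subst mat_of_rows_row) (auto simp: nth_append rows_def)
  let ?B = "mat_of_cols n (cols B @ [u])"
  have B': "?B \<in> carrier_mat n (Suc r)" using B by (auto intro: carrier_matI)
  have colB': "col ?B k = (if k < r then col B k else u)" if "k < Suc r" for k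
    using that B u by (subst col_mat_of_cols) (auto simp: nth_append cols_def)
  have cB: "c \<bullet> col B k = 0" if k: "k < r" for k
  proof -
    have "C *\<^sub>v col B k = col (C * B) k" using C B k by (auto intro!: eq_vecI)
    also have "\<dots> = unit_vec r k" using CB k by (simp)
    finally have "B *\<^sub>v (C *\<^sub>v col B k) = col B k"
      using B k by (auto intro!: eq_vecI simp: scalar_prod_right_unit)
    then show ?thesis using cv[of "col B k"] B k by auto
  qed
  have "C' * ?B = 1\<^sub>m (Suc r)"
  proof (rule eq_matI)
    fix k l assume "k < dim_row (1\<^sub>m (Suc r) :: 'f mat)" "l < dim_col (1\<^sub>m (Suc r) :: 'f mat)"
    then have kl: "k < Suc r" "l < Suc r" by auto
    have "(C' * ?B) $$ (k, l) = row C' k \<bullet> col ?B l"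
      using kl carrier_matD[OF C'] carrier_matD[OF B'] by (subst index_mult_mat) auto
    also have "\<dots> = (1\<^sub>m (Suc r) :: 'f mat) $$ (k, l)"
    proof (cases "k < r"; cases "l < r")
      assume "k < r" "l < r"
      then have "row C k \<bullet> col B l = (C * B) $$ (k, l)" using C B by simp
      then show ?thesis using \<open>k < r\<close> \<open>l < r\<close> kl CB by (simp add: rowC' colB')
    next
      assume "k < r" "\<not> l < r"
      then have "row C k \<bullet> u = (C *\<^sub>v u) $ k" using C by simp
      then show ?thesis using \<open>k < r\<close> \<open>\<not> l < r\<close> kl Cu by (simp add: rowC' colB')
    next
      assume "\<not> k < r" "l < r"
      then show ?thesis using kl cB by (simp add: rowC' colB')
    next
      assume "\<not> k < r" "\<not> l < r"
      then show ?thesis using kl cv[OF u(1)] i B Cu u by (simp add: rowC' colB' less_Suc_eq)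
    qed
    finally show "(C' * ?B) $$ (k, l) = (1\<^sub>m (Suc r) :: 'f mat) $$ (k, l)" .
  qed (use C' B' in auto)
  with C' show ?thesis by blast
qed

text \<open>Every subspace of the space of column vectors is the image of an idempotent \<open>B * C\<close> that factors
through a space of column vectors. A factorisation of maximal size works: if some vector \<open>w\<close> of \<open>W\<close>
were not fixed, it could be enlarged by \<open>w - B * C * w\<close>.\<close>

lemma subspace_projection:
  fixes W :: "'f::field vec set"
  assumes W: "VectorSpace.subspace class_ring W (module_vec TYPE('f) n)"
  obtains r B C where "B \<in> carrier_mat n r" "C \<in> carrier_mat r n" "C * B = 1\<^sub>m r"
    "\<And>j. j < r \<Longrightarrow> col B j \<in> W" "\<And>w. w \<in> W \<Longrightarrow> B *\<^sub>v (C *\<^sub>v w) = w"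
proof -
  define P where "P r \<longleftrightarrow> (\<exists>B\<in>carrier_mat n r. \<exists>C\<in>carrier_mat r n. C * B = 1\<^sub>m r \<and> (\<forall>j<r. col B j \<in> W))" for r
  have bound: "r \<le> n" if "P r" for r using that left_inverse_dim_le unfolding P_def by blast
  have "P 0" unfolding P_def
    by (rule bexI[of _ "0\<^sub>m n 0"], rule bexI[of _ "0\<^sub>m 0 n"]) auto
  define r where "r = Greatest P"
  have "P r" unfolding r_def using bound by (intro GreatestI_nat[of P, OF \<open>P 0\<close>]) auto
  have nP: "\<not> P (Suc r)"
    using Greatest_le_nat[of P "Suc r" n] bound unfolding r_def by auto
  obtain B C where B: "B \<in> carrier_mat n r" and C: "C \<in> carrier_mat r n" and CB: "C * B = 1\<^sub>m r"
    and cols: "\<And>j. j < r \<Longrightarrow> col B j \<in> W"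
    using \<open>P r\<close> unfolding P_def by blast
  have "B *\<^sub>v (C *\<^sub>v w) = w" if w: "w \<in> W" for w
  proof (rule ccontr)
    assume ne: "B *\<^sub>v (C *\<^sub>v w) \<noteq> w"
    define u where "u = w + (- 1) \<cdot>\<^sub>v (B *\<^sub>v (C *\<^sub>v w))"
    have wn: "w \<in> carrier_vec n" using W w by (auto simp: subspace_vec_iff)
    have BCw: "B *\<^sub>v (C *\<^sub>v w) \<in> W"
      using C wn by (intro subspace_mult_mat_vec[OF W B cols]) auto
    have u: "u \<in> W" using W w BCw unfolding u_def by (auto simp: subspace_vec_iff)
    then have un: "u \<in> carrier_vec n" using W by (auto simp: subspace_vec_iff)
    have u0: "u \<noteq> 0\<^sub>v n"
    proof
      assume "u = 0\<^sub>v n"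
      then have "w $ i = (B *\<^sub>v (C *\<^sub>v w)) $ i" if "i < n" for i
      proof -
        have "u $ i = w $ i - (B *\<^sub>v (C *\<^sub>v w)) $ i"
          using that B by (simp add: u_def)
        then show ?thesis using \<open>u = 0\<^sub>v n\<close> that by simp
      qed
      then show False using ne B wn by (metis carrier_matD(1) carrier_vecD dim_mult_mat_vec eq_vecI)
    qed
    have CBCw: "C *\<^sub>v (B *\<^sub>v (C *\<^sub>v w)) = C *\<^sub>v w"
      using C B CB wn by (simp flip: assoc_mult_mat_vec[of C r n B r "C *\<^sub>v w"])
    have "C *\<^sub>v u = C *\<^sub>v w + (- 1) \<cdot>\<^sub>v (C *\<^sub>v w)"
      unfolding u_def using B C wn by (subst mult_add_distrib_mat_vec[OF C]) (auto simp: mult_mat_vec CBCw)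
    then have Cu: "C *\<^sub>v u = 0\<^sub>v r" using C wn by auto
    from subspace_projection_extend[OF B C CB un u0 Cu] obtain C'
      where C': "C' \<in> carrier_mat (Suc r) n" "C' * mat_of_cols n (cols B @ [u]) = 1\<^sub>m (Suc r)" by blast
    have "P (Suc r)" unfolding P_def
    proof (intro bexI conjI allI impI)
      show "mat_of_cols n (cols B @ [u]) \<in> carrier_mat n (Suc r)" using B by (auto intro: carrier_matI)
      fix j assume "j < Suc r"
      then show "col (mat_of_cols n (cols B @ [u])) j \<in> W"
        using B un u cols by (subst col_mat_of_cols) (auto simp: nth_append cols_def)
    qed (use C' in auto)
    then show False using nP by simp
  qed
  then show ?thesis using that B C CB cols by blast
qed

lemma col_mult_mat: "A \<in> carrier_mat m n \<Longrightarrow> B \<in> carrier_mat n k \<Longrightarrow> j < k \<Longrightarrow> col (A * B) j = A *\<^sub>v col B j"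
  by (rule eq_vecI) auto

lemma mult_mat_eqI:
  assumes A: "A \<in> carrier_mat m n" and B: "B \<in> carrier_mat n k" and X: "X \<in> carrier_mat m k"
    and cols: "\<And>j. j < k \<Longrightarrow> A *\<^sub>v col B j = col X j"
  shows "A * B = X"
proof (rule mat_col_eqI)
  fix j assume "j < dim_col X"
  then have "j < k" using X by simp
  then show "col (A * B) j = col X j" unfolding col_mult_mat[OF A B \<open>j < k\<close>] by (rule cols)
qed (use A B X in auto)

lemma mult_mat_inner_dim_0: "A \<in> carrier_mat m 0 \<Longrightarrow> B \<in> carrier_mat 0 n \<Longrightarrow> A * B = 0\<^sub>m m n"
  by (rule eq_matI) (auto simp: scalar_prod_def)

lemma smult_mat_mult_vec:
  "(A :: 'f::comm_semiring_0 mat) \<in> carrier_mat m n \<Longrightarrow> v \<in> carrier_vec n \<Longrightarrow> (c \<cdot>\<^sub>m A) *\<^sub>v v = c \<cdot>\<^sub>v (A *\<^sub>v v)"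
  by (rule eq_vecI) (auto simp: scalar_prod_def sum_distrib_left mult.assoc intro!: sum.cong)

text \<open>The matrix type fixes no dimensions and so carries no additive monoid; the sum over an
index set therefore has the dimensions as explicit arguments.\<close>

definition mat_sum :: "nat \<Rightarrow> nat \<Rightarrow> ('s \<Rightarrow> 'f::comm_semiring_0 mat) \<Rightarrow> 's set \<Rightarrow> 'f mat" where
  "mat_sum m n f S = mat m n (\<lambda>(i, j). \<Sum>s\<in>S. f s $$ (i, j))"

lemma mat_sum_carrier [simp]: "mat_sum m n f S \<in> carrier_mat m n"
  by (simp add: mat_sum_def)

lemma mat_sum_index [simp]: "i < m \<Longrightarrow> j < n \<Longrightarrow> mat_sum m n f S $$ (i, j) = (\<Sum>s\<in>S. f s $$ (i, j))"
  by (simp add: mat_sum_def)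

lemma mat_sum_cong: "(\<And>s. s \<in> S \<Longrightarrow> f s = g s) \<Longrightarrow> mat_sum m n f S = mat_sum m n g S"
  by (auto simp: mat_sum_def intro!: eq_matI sum.cong)

lemma index_mult_mat_sum:
  assumes "A \<in> carrier_mat n m" "B \<in> carrier_mat m k" "i < n" "j < k"
  shows "(A * B) $$ (i, j) = (\<Sum>l<m. A $$ (i, l) * B $$ (l, j))"
  using assms by (auto simp: scalar_prod_def atLeast0LessThan intro!: sum.cong)

lemma index_mult_mat_unit_vec:
  fixes A :: "'f::semiring_1 mat"
  assumes "A \<in> carrier_mat m n" "i < m" "j < n"
  shows "(A *\<^sub>v unit_vec n j) $ i = A $$ (i, j)"
  using assms by (simp add: scalar_prod_right_unit)

lemma mult_mat_sum:
  assumes P: "P \<in> carrier_mat k m" and f: "\<And>s. s \<in> S \<Longrightarrow> f s \<in> carrier_mat m n"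
  shows "P * mat_sum m n f S = mat_sum k n (\<lambda>s. P * f s) S"
proof (rule eq_matI)
  fix i j assume "i < dim_row (mat_sum k n (\<lambda>s. P * f s) S)" "j < dim_col (mat_sum k n (\<lambda>s. P * f s) S)"
  then have ij: "i < k" "j < n" by (auto simp: mat_sum_def)
  have "(P * mat_sum m n f S) $$ (i, j) = (\<Sum>l<m. P $$ (i, l) * (\<Sum>s\<in>S. f s $$ (l, j)))"
    using ij P by (auto simp: mat_sum_def scalar_prod_def atLeast0LessThan intro!: sum.cong)
  also have "\<dots> = (\<Sum>s\<in>S. \<Sum>l<m. P $$ (i, l) * f s $$ (l, j))"
    by (subst sum.swap) (simp add: sum_distrib_left)
  also have "\<dots> = (\<Sum>s\<in>S. (P * f s) $$ (i, j))"
    using ij by (intro sum.cong refl index_mult_mat_sum[OF P f, symmetric]) auto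
  finally show "(P * mat_sum m n f S) $$ (i, j) = mat_sum k n (\<lambda>s. P * f s) S $$ (i, j)"
    using ij by simp
qed (use P in \<open>auto simp: mat_sum_def\<close>)

lemma mat_sum_mult:
  assumes P: "P \<in> carrier_mat n k" and f: "\<And>s. s \<in> S \<Longrightarrow> f s \<in> carrier_mat m n"
  shows "mat_sum m n f S * P = mat_sum m k (\<lambda>s. f s * P) S"
proof (rule eq_matI)
  fix i j assume "i < dim_row (mat_sum m k (\<lambda>s. f s * P) S)" "j < dim_col (mat_sum m k (\<lambda>s. f s * P) S)"
  then have ij: "i < m" "j < k" by (auto simp: mat_sum_def)
  have "(mat_sum m n f S * P) $$ (i, j) = (\<Sum>l<n. (\<Sum>s\<in>S. f s $$ (i, l)) * P $$ (l, j))"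
    using ij P by (auto simp: mat_sum_def scalar_prod_def atLeast0LessThan intro!: sum.cong)
  also have "\<dots> = (\<Sum>s\<in>S. \<Sum>l<n. f s $$ (i, l) * P $$ (l, j))"
    by (subst sum.swap) (simp add: sum_distrib_right)
  also have "\<dots> = (\<Sum>s\<in>S. (f s * P) $$ (i, j))"
    using ij by (intro sum.cong refl index_mult_mat_sum[OF f P, symmetric]) auto
  finally show "(mat_sum m n f S * P) $$ (i, j) = mat_sum m k (\<lambda>s. f s * P) S $$ (i, j)"
    using ij by simp
qed (use P in \<open>auto simp: mat_sum_def\<close>)

lemma mat_trace_mat_sum:
  assumes "\<And>s. s \<in> S \<Longrightarrow> f s \<in> carrier_mat n n"
  shows "mat_trace (mat_sum n n f S) = (\<Sum>s\<in>S. mat_trace (f s))"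
proof -
  have "mat_trace (mat_sum n n f S) = (\<Sum>s\<in>S. \<Sum>i<n. f s $$ (i, i))"
    by (simp add: mat_trace_def mat_sum_def) (rule sum.swap)
  also have "\<dots> = (\<Sum>s\<in>S. mat_trace (f s))"
    using assms by (intro sum.cong refl) (auto simp: mat_trace_def)
  finally show ?thesis .
qed

section \<open>Schur's lemma\<close>

locale finite_group = group G for G (structure) +
  assumes finite_carrier [simp]: "finite (carrier G)"

context group begin

text \<open>The unit of the matrix ring needs an argument: \<open>\<rho> \<one>\<close> is idempotent and invertible.\<close>

lemma representation_iff:
  "representation G n \<rho> \<longleftrightarrow>
     (\<forall>g\<in>carrier G. \<rho> g \<in> carrier_mat n n) \<and> \<rho> \<one> = 1\<^sub>m n \<and>
     (\<forall>g\<in>carrier G. \<forall>h\<in>carrier G. \<rho> (g \<otimes> h) = \<rho> g * \<rho> h)" (is "?L \<longleftrightarrow> ?R")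
proof
  assume ?L
  then have U: "\<rho> g \<in> Units (ring_mat TYPE(complex) n ())" if "g \<in> carrier G" for g
    using that by (auto simp: representation_def hom_def units_of_carrier)
  then have car: "\<rho> g \<in> carrier_mat n n" if "g \<in> carrier G" for g
    using that by (auto simp: Units_def ring_mat_simps)
  have mult: "\<rho> (g \<otimes> h) = \<rho> g * \<rho> h" if "g \<in> carrier G" "h \<in> carrier G" for g h
    using \<open>?L\<close> that by (auto simp: representation_def hom_def units_of_mult ring_mat_simps)
  obtain Y where Y: "Y \<in> carrier_mat n n" "Y * \<rho> \<one> = 1\<^sub>m n"
    using U[of \<one>] by (auto simp: Units_def ring_mat_simps)
  have "\<rho> \<one> = (Y * \<rho> \<one>) * \<rho> \<one>" using Y car[of \<one>] by simp
  also have "\<dots> = Y * (\<rho> \<one> * \<rho> \<one>)" using Y car[of \<one>] by (intro assoc_mult_mat) auto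
  also have "\<dots> = 1\<^sub>m n" using Y mult[of \<one> \<one>] by simp
  finally show ?R using car mult by blast
next
  assume R: ?R
  have "\<rho> g \<in> Units (ring_mat TYPE(complex) n ())" if g: "g \<in> carrier G" for g
  proof -
    have "\<rho> g * \<rho> (inv g) = 1\<^sub>m n" "\<rho> (inv g) * \<rho> g = 1\<^sub>m n"
      using R g by (metis inv_closed r_inv, metis inv_closed l_inv)
    then show ?thesis using R g by (auto simp: Units_def ring_mat_simps)
  qed
  then show ?L using R
    by (auto simp: representation_def hom_def units_of_carrier units_of_mult ring_mat_simps)
qed

lemma representationD:
  assumes "representation G n \<rho>"
  shows "g \<in> carrier G \<Longrightarrow> \<rho> g \<in> carrier_mat n n" "\<rho> \<one> = 1\<^sub>m n"
    "g \<in> carrier G \<Longrightarrow> h \<in> carrier G \<Longrightarrow> \<rho> (g \<otimes> h) = \<rho> g * \<rho> h"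
    "g \<in> carrier G \<Longrightarrow> \<rho> g * \<rho> (inv g) = 1\<^sub>m n" "g \<in> carrier G \<Longrightarrow> \<rho> (inv g) * \<rho> g = 1\<^sub>m n"
proof -
  show "g \<in> carrier G \<Longrightarrow> \<rho> g * \<rho> (inv g) = 1\<^sub>m n" "g \<in> carrier G \<Longrightarrow> \<rho> (inv g) * \<rho> g = 1\<^sub>m n"
    using assms unfolding representation_iff by (metis inv_closed r_inv, metis inv_closed l_inv)
qed (use assms in \<open>auto simp: representation_iff\<close>)

lemma irreducible_representationD:
  assumes "irreducible_representation G n \<rho>"
  shows "representation G n \<rho>" "n > 0"
    "VectorSpace.subspace class_ring W (module_vec TYPE(complex) n) \<Longrightarrow>
      (\<And>g w. g \<in> carrier G \<Longrightarrow> w \<in> W \<Longrightarrow> \<rho> g *\<^sub>v w \<in> W) \<Longrightarrow> W = {0\<^sub>v n} \<or> W = carrier_vec n"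
  using assms by (auto simp: irreducible_representation_def)

text \<open>The half of Schur's lemma that uses irreducibility of the source: the kernel of an intertwiner is an
invariant subspace.\<close>

lemma intertwiner_kernel:
  assumes irr: "irreducible_representation G n \<rho>"
    and \<sigma>: "\<And>g. g \<in> carrier G \<Longrightarrow> \<sigma> g \<in> carrier_mat m m"
    and T: "T \<in> carrier_mat m n" and comm: "\<And>g. g \<in> carrier G \<Longrightarrow> T * \<rho> g = \<sigma> g * T"
  shows "T = 0\<^sub>m m n \<or> (\<forall>v\<in>carrier_vec n. T *\<^sub>v v = 0\<^sub>v m \<longrightarrow> v = 0\<^sub>v n)"
proof -
  note \<rho> = representationD[OF irreducible_representationD(1)[OF irr]]
  define W where "W = {v \<in> carrier_vec n. T *\<^sub>v v = 0\<^sub>v m}"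
  have "VectorSpace.subspace class_ring W (module_vec TYPE(complex) n)"
    using T by (auto simp: subspace_vec_iff W_def mult_add_distrib_mat_vec mult_mat_vec)
  moreover have "\<rho> g *\<^sub>v w \<in> W" if g: "g \<in> carrier G" and w: "w \<in> W" for g w
  proof -
    have wn: "w \<in> carrier_vec n" and Tw: "T *\<^sub>v w = 0\<^sub>v m" using w by (auto simp: W_def)
    have "T *\<^sub>v (\<rho> g *\<^sub>v w) = (T * \<rho> g) *\<^sub>v w"
      using T \<rho>(1)[OF g] wn by (simp add: assoc_mult_mat_vec)
    also have "\<dots> = \<sigma> g *\<^sub>v (T *\<^sub>v w)"
      using T \<sigma>[OF g] wn by (simp add: comm[OF g] assoc_mult_mat_vec)
    also have "\<dots> = 0\<^sub>v m" using \<sigma>[OF g] Tw by auto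
    finally show ?thesis using \<rho>(1)[OF g] wn by (auto simp: W_def)
  qed
  ultimately consider "W = {0\<^sub>v n}" | "W = carrier_vec n"
    using irreducible_representationD(3)[OF irr] by blast
  then show ?thesis
  proof cases
    case 1
    then show ?thesis by (auto simp: W_def)
  next
    case 2
    have "T = 0\<^sub>m m n"
    proof (rule eq_matI)
      fix i j assume "i < dim_row (0\<^sub>m m n :: complex mat)" "j < dim_col (0\<^sub>m m n :: complex mat)"
      then have ij: "i < m" "j < n" by auto
      have "unit_vec n j \<in> W" using 2 by simp
      then have "(T *\<^sub>v unit_vec n j) $ i = 0" using ij by (simp add: W_def)
      then show "T $$ (i, j) = 0\<^sub>m m n $$ (i, j)" using ij T by (simp add: scalar_prod_right_unit)
    qed (use T in auto)
    then show ?thesis ..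
  qed
qed

text \<open>The kernel and the image of an intertwiner \<open>T\<close> are invariant, so a nonzero \<open>T\<close> is bijective. With
its inverse \<open>S\<close>, cyclicity of the trace gives equality of the characters.\<close>

lemma intertwiner_zero_or_same_character:
  assumes irr\<rho>: "irreducible_representation G n \<rho>" and irr\<sigma>: "irreducible_representation G m \<sigma>"
    and T: "T \<in> carrier_mat m n" and comm: "\<And>g. g \<in> carrier G \<Longrightarrow> T * \<rho> g = \<sigma> g * T"
  shows "T = 0\<^sub>m m n \<or> character_of G \<rho> = character_of G \<sigma>"
proof (rule disjCI)
  assume diff: "character_of G \<rho> \<noteq> character_of G \<sigma>"
  show "T = 0\<^sub>m m n"
  proof (rule ccontr)
    assume T0: "T \<noteq> 0\<^sub>m m n"
    note \<rho> = representationD[OF irreducible_representationD(1)[OF irr\<rho>]]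
    note \<sigma> = representationD[OF irreducible_representationD(1)[OF irr\<sigma>]]
    have inj: "v = 0\<^sub>v n" if "v \<in> carrier_vec n" "T *\<^sub>v v = 0\<^sub>v m" for v
      using intertwiner_kernel[OF irr\<rho> \<sigma>(1) T comm] T0 that by auto
    \<comment> \<open>the image of \<open>T\<close>\<close>
    define W where "W = (*\<^sub>v) T ` carrier_vec n"
    have "VectorSpace.subspace class_ring W (module_vec TYPE(complex) m)"
      unfolding subspace_vec_iff
    proof (intro conjI ballI allI)
      show "W \<subseteq> carrier_vec m" using T by (auto simp: W_def)
      have "T *\<^sub>v 0\<^sub>v n = 0\<^sub>v m" using T by auto
      then show "0\<^sub>v m \<in> W" unfolding W_def by (metis image_eqI zero_carrier_vec)
    next
      fix v w assume "v \<in> W" "w \<in> W"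
      then obtain v' w' where "v' \<in> carrier_vec n" "w' \<in> carrier_vec n" "v = T *\<^sub>v v'" "w = T *\<^sub>v w'"
        by (auto simp: W_def)
      then have "v + w = T *\<^sub>v (v' + w')" "v' + w' \<in> carrier_vec n"
        using T by (auto simp: mult_add_distrib_mat_vec)
      then show "v + w \<in> W" by (auto simp: W_def)
    next
      fix c v assume "v \<in> W"
      then obtain v' where "v' \<in> carrier_vec n" "v = T *\<^sub>v v'" by (auto simp: W_def)
      then have "c \<cdot>\<^sub>v v = T *\<^sub>v (c \<cdot>\<^sub>v v')" "c \<cdot>\<^sub>v v' \<in> carrier_vec n"
        using T by (auto simp: mult_mat_vec)
      then show "c \<cdot>\<^sub>v v \<in> W" by (auto simp: W_def)
    qed
    moreover have "\<sigma> g *\<^sub>v w \<in> W" if g: "g \<in> carrier G" and w: "w \<in> W" for g w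
    proof -
      obtain v where v: "v \<in> carrier_vec n" "w = T *\<^sub>v v" using w by (auto simp: W_def)
      have "\<sigma> g *\<^sub>v w = (\<sigma> g * T) *\<^sub>v v" using v T \<sigma>(1)[OF g] by (simp add: assoc_mult_mat_vec)
      also have "\<dots> = T *\<^sub>v (\<rho> g *\<^sub>v v)"
        using v T \<rho>(1)[OF g] by (simp add: assoc_mult_mat_vec flip: comm[OF g])
      finally show ?thesis using v \<rho>(1)[OF g] by (auto simp: W_def)
    qed
    ultimately have "W = {0\<^sub>v m} \<or> W = carrier_vec m"
      using irreducible_representationD(3)[OF irr\<sigma>] by blast
    moreover have "W \<noteq> {0\<^sub>v m}"
    proof
      assume "W = {0\<^sub>v m}"
      then have "T *\<^sub>v unit_vec n 0 = 0\<^sub>v m" by (auto simp: W_def)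
      then have "unit_vec n 0 = (0\<^sub>v n :: complex vec)" using inj by auto
      then have "unit_vec n 0 $ 0 = (0 :: complex)"
        using irreducible_representationD(2)[OF irr\<rho>] by simp
      then show False using irreducible_representationD(2)[OF irr\<rho>] by simp
    qed
    ultimately have W: "W = carrier_vec m" by blast
    have "\<exists>v\<in>carrier_vec n. T *\<^sub>v v = unit_vec m j" for j
      using W unit_vec_carrier[of m j] unfolding W_def by (metis imageE)
    then obtain s where s: "\<And>j. s j \<in> carrier_vec n" "\<And>j. T *\<^sub>v s j = unit_vec m j" by metis
    \<comment> \<open>a right inverse, from preimages of the unit vectors; injectivity of \<open>T\<close> makes it a left inverse\<close>
    define S where "S = mat_of_cols n (map s [0..<m])"
    have S: "S \<in> carrier_mat n m" by (auto simp: S_def intro: carrier_matI)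
    have TS: "T * S = 1\<^sub>m m"
    proof (rule eq_matI)
      fix i j assume "i < dim_row (1\<^sub>m m :: complex mat)" "j < dim_col (1\<^sub>m m :: complex mat)"
      then have ij: "i < m" "j < m" by auto
      have "col S j = s j" unfolding S_def using s ij by (subst col_mat_of_cols) auto
      then have "(T * S) $$ (i, j) = (T *\<^sub>v s j) $ i" using ij T S by simp
      then show "(T * S) $$ (i, j) = 1\<^sub>m m $$ (i, j)" using ij s by simp
    qed (use T S in auto)
    have ST: "S * T = 1\<^sub>m n"
    proof (rule eq_matI)
      fix i j assume "i < dim_row (1\<^sub>m n :: complex mat)" "j < dim_col (1\<^sub>m n :: complex mat)"
      then have ij: "i < n" "j < n" by auto
      define v where "v = S *\<^sub>v (T *\<^sub>v unit_vec n j) + (- 1) \<cdot>\<^sub>v unit_vec n j"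
      have v: "v \<in> carrier_vec n" using S T by (auto simp: v_def)
      have "T *\<^sub>v (S *\<^sub>v (T *\<^sub>v unit_vec n j)) = (T * S) *\<^sub>v (T *\<^sub>v unit_vec n j)"
        using S T by (simp add: assoc_mult_mat_vec[of _ m n])
      then have "T *\<^sub>v (S *\<^sub>v (T *\<^sub>v unit_vec n j)) = T *\<^sub>v unit_vec n j" using T TS by simp
      then have "T *\<^sub>v v = T *\<^sub>v unit_vec n j + (- 1) \<cdot>\<^sub>v (T *\<^sub>v unit_vec n j)"
        unfolding v_def using T S
        by (subst mult_add_distrib_mat_vec[OF T]) (auto simp: mult_mat_vec)
      then have "T *\<^sub>v v = 0\<^sub>v m" using T by auto
      then have "v $ i = 0" using inj[OF v] ij by simp
      moreover have "v $ i = (S *\<^sub>v (T *\<^sub>v unit_vec n j)) $ i - unit_vec n j $ i"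
        using ij S by (simp add: v_def)
      moreover have "(S *\<^sub>v (T *\<^sub>v unit_vec n j)) $ i = (S * T) $$ (i, j)"
        unfolding assoc_mult_mat_vec[OF S T unit_vec_carrier, symmetric]
        by (rule index_mult_mat_unit_vec[OF mult_carrier_mat[OF S T] ij])
      ultimately have "(S * T) $$ (i, j) = unit_vec n j $ i" by (metis eq_iff_diff_eq_0)
      then show "(S * T) $$ (i, j) = 1\<^sub>m n $$ (i, j)" using ij by simp
    qed (use T S in auto)
    have "mat_trace (\<rho> g) = mat_trace (\<sigma> g)" if g: "g \<in> carrier G" for g
    proof -
      have "mat_trace (\<rho> g) = mat_trace ((S * T) * \<rho> g)"
        unfolding ST left_mult_one_mat[OF \<rho>(1)[OF g]] ..
      also have "(S * T) * \<rho> g = S * (\<sigma> g * T)"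
        unfolding assoc_mult_mat[OF S T \<rho>(1)[OF g]] comm[OF g] ..
      also have "mat_trace \<dots> = mat_trace ((\<sigma> g * T) * S)"
        using S T \<sigma>(1)[OF g] by (intro mat_trace_mult_comm[of _ n m]) auto
      also have "(\<sigma> g * T) * S = \<sigma> g"
        unfolding assoc_mult_mat[OF \<sigma>(1)[OF g] T S] TS by (rule right_mult_one_mat[OF \<sigma>(1)[OF g]])
      finally show ?thesis .
    qed
    then have "character_of G \<rho> = character_of G \<sigma>"
      by (auto simp: character_of_def restrict_def fun_eq_iff)
    then show False using diff by simp
  qed
qed

text \<open>Over the complex numbers \<open>T\<close> has an eigenvalue \<open>k\<close>, and \<open>T - k\<close> is an intertwiner with nonzero
kernel.\<close>

lemma intertwiner_scalar:
  assumes irr: "irreducible_representation G n \<rho>"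
    and T: "T \<in> carrier_mat n n" and comm: "\<And>g. g \<in> carrier G \<Longrightarrow> T * \<rho> g = \<rho> g * T"
  shows "\<exists>k. T = k \<cdot>\<^sub>m 1\<^sub>m n"
proof -
  note \<rho> = representationD[OF irreducible_representationD(1)[OF irr]]
  obtain k v where "eigenvector T v k"
    using spectrum_non_empty[OF T irreducible_representationD(2)[OF irr]]
    by (auto simp: spectrum_def eigenvalue_def)
  then have v: "v \<in> carrier_vec n" "v \<noteq> 0\<^sub>v n" "T *\<^sub>v v = k \<cdot>\<^sub>v v"
    using T by (auto simp: eigenvector_def)
  define D where "D = T + (- k) \<cdot>\<^sub>m 1\<^sub>m n"
  have D: "D \<in> carrier_mat n n" using T by (simp add: D_def)
  have commD: "D * \<rho> g = \<rho> g * D" if g: "g \<in> carrier G" for g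
  proof -
    have "D * \<rho> g = T * \<rho> g + (- k) \<cdot>\<^sub>m \<rho> g"
      unfolding D_def using T \<rho>(1)[OF g]
      by (subst add_mult_distrib_mat[of _ n n]) (auto simp: mult_smult_assoc_mat[of _ n n _ n])
    moreover have "\<rho> g * D = \<rho> g * T + (- k) \<cdot>\<^sub>m \<rho> g"
      unfolding D_def using T \<rho>(1)[OF g]
      by (subst mult_add_distrib_mat[of _ n n]) (auto simp: mult_smult_distrib[of _ n n _ n])
    ultimately show ?thesis using comm[OF g] by simp
  qed
  have "D *\<^sub>v v = T *\<^sub>v v + (- k) \<cdot>\<^sub>v v"
    unfolding D_def using T v by (subst add_mult_distrib_mat_vec[of _ n n]) (auto simp: smult_mat_mult_vec)
  then have "D *\<^sub>v v = 0\<^sub>v n" using v by auto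
  then have "D = 0\<^sub>m n n" using intertwiner_kernel[OF irr \<rho>(1) D commD] v by auto
  have "T = k \<cdot>\<^sub>m 1\<^sub>m n"
  proof (rule eq_matI)
    fix i j assume "i < dim_row (k \<cdot>\<^sub>m 1\<^sub>m n)" "j < dim_col (k \<cdot>\<^sub>m 1\<^sub>m n)"
    then have ij: "i < n" "j < n" by auto
    have "D $$ (i, j) = T $$ (i, j) - (k \<cdot>\<^sub>m 1\<^sub>m n) $$ (i, j)" using ij T by (auto simp: D_def)
    then show "T $$ (i, j) = (k \<cdot>\<^sub>m 1\<^sub>m n) $$ (i, j)" using ij \<open>D = 0\<^sub>m n n\<close> by simp
  qed (use T in auto)
  then show ?thesis by blast
qed

end

section \<open>First orthogonality relation\<close>

context finite_group begin

text \<open>The average (up to the factor \<open>|G|\<close>) of a linear map \<open>A\<close> over the action of the group, which turns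
an arbitrary linear map into an intertwiner.\<close>

definition group_average :: "nat \<Rightarrow> nat \<Rightarrow> ('a \<Rightarrow> complex mat) \<Rightarrow> ('a \<Rightarrow> complex mat) \<Rightarrow> complex mat \<Rightarrow> complex mat" where
  "group_average m n \<sigma> \<rho> A = mat_sum m n (\<lambda>g. \<sigma> g * A * \<rho> (inv g)) (carrier G)"

lemma sum_left_translate: "h \<in> carrier G \<Longrightarrow> (\<Sum>g\<in>carrier G. f (h \<otimes> g)) = (\<Sum>g\<in>carrier G. f g)"
  by (rule sum.reindex_bij_witness[of _ "\<lambda>g. inv h \<otimes> g" "\<lambda>g. h \<otimes> g"])
    (auto simp flip: m_assoc)

lemma group_average_carrier [simp]: "group_average m n \<sigma> \<rho> A \<in> carrier_mat m n"
  by (simp add: group_average_def)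

lemma group_average_intertwines:
  assumes \<sigma>: "representation G m \<sigma>" and \<rho>: "representation G n \<rho>" and A: "A \<in> carrier_mat m n"
    and h: "h \<in> carrier G"
  shows "group_average m n \<sigma> \<rho> A * \<rho> h = \<sigma> h * group_average m n \<sigma> \<rho> A"
proof -
  note \<rho>' = representationD[OF \<rho>] and \<sigma>' = representationD[OF \<sigma>]
  define F where "F g = \<sigma> g * A * \<rho> (inv g)" for g
  have F: "F g \<in> carrier_mat m n" if "g \<in> carrier G" for g
    using that \<rho>'(1)[of "inv g"] \<sigma>'(1)[of g] A by (simp add: F_def)
  have Fh: "F (h \<otimes> g) * \<rho> h = \<sigma> h * F g" if g: "g \<in> carrier G" for g
  proof -
    note c = \<sigma>'(1)[OF g] \<sigma>'(1)[OF h] \<rho>'(1)[OF h] \<rho>'(1)[of "inv g", OF inv_closed[OF g]]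
      \<rho>'(1)[of "inv h", OF inv_closed[OF h]]
    have 1: "\<sigma> (h \<otimes> g) * A = \<sigma> h * (\<sigma> g * A)"
      using assoc_mult_mat[OF c(2) c(1) A] g h by (simp add: \<sigma>'(3))
    have "\<rho> (inv (h \<otimes> g)) * \<rho> h = \<rho> (inv g) * (\<rho> (inv h) * \<rho> h)"
      using assoc_mult_mat[OF c(4) c(5) c(3)] g h by (simp add: \<rho>'(3) inv_mult_group)
    also have "\<dots> = \<rho> (inv g)" using h right_mult_one_mat[OF c(4)] by (simp add: \<rho>'(5))
    finally have 2: "\<rho> (inv (h \<otimes> g)) * \<rho> h = \<rho> (inv g)" .
    have hg: "\<rho> (inv (h \<otimes> g)) \<in> carrier_mat n n" using g h by (intro \<rho>'(1)) simp
    have "F (h \<otimes> g) * \<rho> h = (\<sigma> h * (\<sigma> g * A)) * (\<rho> (inv (h \<otimes> g)) * \<rho> h)"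
      unfolding F_def 1 using c A hg by (intro assoc_mult_mat[of _ m n]) auto
    also have "\<dots> = \<sigma> h * F g"
      unfolding F_def 2 using c A by (intro assoc_mult_mat[of _ m m]) auto
    finally show ?thesis .
  qed
  have "group_average m n \<sigma> \<rho> A = mat_sum m n (\<lambda>g. F (h \<otimes> g)) (carrier G)"
    using sum_left_translate[OF h, of "\<lambda>g. F g $$ _"]
    unfolding group_average_def F_def[symmetric] mat_sum_def by (simp cong: sum.cong)
  then have "group_average m n \<sigma> \<rho> A * \<rho> h = mat_sum m n (\<lambda>g. F (h \<otimes> g) * \<rho> h) (carrier G)"
    using F h by (simp add: mat_sum_mult[OF \<rho>'(1)[OF h]])
  also have "\<dots> = mat_sum m n (\<lambda>g. \<sigma> h * F g) (carrier G)"
    using Fh by (intro mat_sum_cong) auto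
  also have "\<dots> = \<sigma> h * group_average m n \<sigma> \<rho> A"
    unfolding group_average_def F_def[symmetric] using F h by (intro mult_mat_sum[OF \<sigma>'(1), symmetric]) auto
  finally show ?thesis .
qed

lemma group_average_trace:
  assumes \<rho>: "representation G n \<rho>" and A: "A \<in> carrier_mat n n"
  shows "mat_trace (group_average n n \<rho> \<rho> A) = of_nat (card (carrier G)) * mat_trace A"
proof -
  note \<rho>' = representationD[OF \<rho>]
  have c: "\<rho> g * A * \<rho> (inv g) \<in> carrier_mat n n" if "g \<in> carrier G" for g
    using \<rho>'(1)[OF that] \<rho>'(1)[OF inv_closed[OF that]] A by simp
  have "mat_trace (\<rho> g * A * \<rho> (inv g)) = mat_trace A" if g: "g \<in> carrier G" for g
  proof -
    note c = \<rho>'(1)[OF g] \<rho>'(1)[OF inv_closed[OF g]]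
    have "mat_trace (\<rho> g * A * \<rho> (inv g)) = mat_trace (\<rho> (inv g) * (\<rho> g * A))"
      using c A by (intro mat_trace_mult_comm[of _ n n]) auto
    also have "\<rho> (inv g) * (\<rho> g * A) = A"
      unfolding assoc_mult_mat[OF c(2) c(1) A, symmetric] \<rho>'(5)[OF g] by (rule left_mult_one_mat[OF A])
    finally show ?thesis .
  qed
  then show ?thesis unfolding group_average_def using c by (subst mat_trace_mat_sum) auto
qed

text \<open>By Schur's lemma the average is a scalar matrix, and its trace determines the scalar.\<close>

lemma group_average_scalar:
  assumes irr: "irreducible_representation G n \<rho>" and A: "A \<in> carrier_mat n n"
  shows "group_average n n \<rho> \<rho> A = (of_nat (card (carrier G)) * mat_trace A / of_nat n) \<cdot>\<^sub>m 1\<^sub>m n"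
proof -
  note rep = irreducible_representationD(1,2)[OF irr]
  obtain k where k: "group_average n n \<rho> \<rho> A = k \<cdot>\<^sub>m 1\<^sub>m n"
    using intertwiner_scalar[OF irr group_average_carrier group_average_intertwines[OF rep(1) rep(1) A]] by blast
  have "of_nat n * k = mat_trace (group_average n n \<rho> \<rho> A)" by (simp add: k mat_trace_def)
  also have "\<dots> = of_nat (card (carrier G)) * mat_trace A" by (rule group_average_trace[OF rep(1) A])
  finally have "k = of_nat (card (carrier G)) * mat_trace A / of_nat n"
    using rep(2) by (simp add: field_simps)
  then show ?thesis using k by simp
qed

lemma IrrE:
  assumes "\<chi> \<in> Irr G"
  obtains n \<rho> where "irreducible_representation G n \<rho>" "\<chi> = character_of G \<rho>"
  using assms by (auto simp: Irr_def)

text \<open>The averages of the matrix units contain all products of matrix coefficients of the two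
representations; the products of diagonal coefficients add up to the product of the traces.\<close>

lemma trace_product_eq_group_average:
  assumes \<sigma>: "representation G m \<sigma>" and \<rho>: "representation G n \<rho>"
  shows "(\<Sum>g\<in>carrier G. mat_trace (\<sigma> g) * mat_trace (\<rho> (inv g))) =
    (\<Sum>i<m. \<Sum>j<n. group_average m n \<sigma> \<rho> (mat m n (\<lambda>kl. if kl = (i, j) then 1 else 0)) $$ (i, j))"
proof -
  note \<rho>' = representationD[OF \<rho>] and \<sigma>' = representationD[OF \<sigma>]
  let ?E = "\<lambda>i j. mat m n (\<lambda>kl. if kl = (i, j) then 1 else 0) :: complex mat"
  have entry: "(\<sigma> g * ?E i j * \<rho> (inv g)) $$ (i, j) = \<sigma> g $$ (i, i) * \<rho> (inv g) $$ (j, j)"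
    if g: "g \<in> carrier G" and ij: "i < m" "j < n" for g i j
  proof -
    note c = \<sigma>'(1)[OF g] \<rho>'(1)[OF inv_closed[OF g]]
    have E: "?E i j \<in> carrier_mat m n" by simp
    have "(\<sigma> g * ?E i j) $$ (i, l) = (if l = j then \<sigma> g $$ (i, i) else 0)" if l: "l < n" for l
    proof -
      have "(\<sigma> g * ?E i j) $$ (i, l) = (\<Sum>k<m. \<sigma> g $$ (i, k) * ?E i j $$ (k, l))"
        by (rule index_mult_mat_sum[OF c(1) E ij(1) l])
      also have "\<dots> = (\<Sum>k<m. if k = i then (if l = j then \<sigma> g $$ (i, i) else 0) else 0)"
        using l by (intro sum.cong) auto
      finally show ?thesis using ij by simp
    qed
    moreover have "(\<sigma> g * ?E i j * \<rho> (inv g)) $$ (i, j) =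
        (\<Sum>l<n. (\<sigma> g * ?E i j) $$ (i, l) * \<rho> (inv g) $$ (l, j))"
      by (rule index_mult_mat_sum[OF mult_carrier_mat[OF c(1) E] c(2) ij])
    ultimately have "(\<sigma> g * ?E i j * \<rho> (inv g)) $$ (i, j) =
        (\<Sum>l<n. (if l = j then \<sigma> g $$ (i, i) else 0) * \<rho> (inv g) $$ (l, j))"
      by simp
    also have "\<dots> = (\<Sum>l<n. if l = j then \<sigma> g $$ (i, i) * \<rho> (inv g) $$ (j, j) else 0)"
      by (intro sum.cong refl) simp
    finally show ?thesis using ij by simp
  qed
  have "(\<Sum>g\<in>carrier G. mat_trace (\<sigma> g) * mat_trace (\<rho> (inv g))) =
      (\<Sum>g\<in>carrier G. \<Sum>i<m. \<Sum>j<n. (\<sigma> g * ?E i j * \<rho> (inv g)) $$ (i, j))"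
  proof (rule sum.cong[OF refl])
    fix g assume g: "g \<in> carrier G"
    have "dim_row (\<sigma> g) = m" "dim_row (\<rho> (inv g)) = n"
      using \<sigma>'(1)[OF g] \<rho>'(1)[OF inv_closed[OF g]] by auto
    then show "mat_trace (\<sigma> g) * mat_trace (\<rho> (inv g)) =
        (\<Sum>i<m. \<Sum>j<n. (\<sigma> g * ?E i j * \<rho> (inv g)) $$ (i, j))"
      using g by (simp add: mat_trace_def sum_product entry)
  qed
  also have "\<dots> = (\<Sum>i<m. \<Sum>g\<in>carrier G. \<Sum>j<n. (\<sigma> g * ?E i j * \<rho> (inv g)) $$ (i, j))"
    by (rule sum.swap)
  also have "\<dots> = (\<Sum>i<m. \<Sum>j<n. \<Sum>g\<in>carrier G. (\<sigma> g * ?E i j * \<rho> (inv g)) $$ (i, j))"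
    by (intro sum.cong refl sum.swap)
  also have "\<dots> = (\<Sum>i<m. \<Sum>j<n. group_average m n \<sigma> \<rho> (?E i j) $$ (i, j))"
    unfolding group_average_def by (intro sum.cong refl) simp
  finally show ?thesis .
qed

text \<open>For different characters all averages of matrix units vanish; for equal ones a single
representation \<open>\<rho>\<close> affords both, and the averages are scalar matrices with known trace.\<close>

theorem first_orthogonality:
  assumes \<chi>: "\<chi> \<in> Irr G" and \<psi>: "\<psi> \<in> Irr G"
  shows "(\<Sum>g\<in>carrier G. \<chi> g * \<psi> (inv g)) = (if \<chi> = \<psi> then of_nat (card (carrier G)) else 0)"
proof (cases "\<chi> = \<psi>")
  case True
  obtain n \<rho> where irr: "irreducible_representation G n \<rho>" and \<chi>': "\<chi> = character_of G \<rho>"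
    using \<chi> by (rule IrrE)
  note rep = irreducible_representationD(1,2)[OF irr]
  let ?E = "\<lambda>i j. mat n n (\<lambda>kl. if kl = (i, j) then 1 else 0) :: complex mat"
  let ?N = "of_nat (card (carrier G)) :: complex"
  have "(\<Sum>g\<in>carrier G. \<chi> g * \<psi> (inv g)) = (\<Sum>i<n. \<Sum>j<n. group_average n n \<rho> \<rho> (?E i j) $$ (i, j))"
    unfolding trace_product_eq_group_average[OF rep(1) rep(1), symmetric]
    by (intro sum.cong refl) (simp add: True[symmetric] \<chi>' character_of_def)
  also have "\<dots> = (\<Sum>i<n. \<Sum>j<n. if j = i then ?N / of_nat n else 0)"
  proof (intro sum.cong refl)
    fix i j assume ij: "i \<in> {..<n}" "j \<in> {..<n}"
    have "mat_trace (?E i j) = (\<Sum>k<n. if k = i then (if j = i then 1 else 0) else 0)"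
      unfolding mat_trace_def by (intro sum.cong) auto
    then have "mat_trace (?E i j) = (if j = i then 1 else 0)" using ij by simp
    then show "group_average n n \<rho> \<rho> (?E i j) $$ (i, j) = (if j = i then ?N / of_nat n else 0)"
      using ij by (subst group_average_scalar[OF irr]) auto
  qed
  also have "\<dots> = ?N" using rep(2) by simp
  finally show ?thesis using True by simp
next
  case False
  obtain m \<sigma> where irr\<sigma>: "irreducible_representation G m \<sigma>" and \<chi>': "\<chi> = character_of G \<sigma>"
    using \<chi> by (rule IrrE)
  obtain n \<rho> where irr\<rho>: "irreducible_representation G n \<rho>" and \<psi>': "\<psi> = character_of G \<rho>"
    using \<psi> by (rule IrrE)
  note rep = irreducible_representationD(1)[OF irr\<sigma>] irreducible_representationD(1)[OF irr\<rho>]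
  have "group_average m n \<sigma> \<rho> A = 0\<^sub>m m n" if A: "A \<in> carrier_mat m n" for A
    using intertwiner_zero_or_same_character[OF irr\<rho> irr\<sigma> group_average_carrier group_average_intertwines[OF rep A]]
      False \<chi>' \<psi>' by auto
  then have "(\<Sum>g\<in>carrier G. mat_trace (\<sigma> g) * mat_trace (\<rho> (inv g))) = 0"
    unfolding trace_product_eq_group_average[OF rep] by (intro sum.neutral ballI) simp
  then show ?thesis using False \<chi>' \<psi>' by (simp add: character_of_def)
qed

lemma Irr_degree:
  assumes "\<chi> \<in> Irr G"
  obtains n where "n > 0" "\<chi> \<one> = of_nat n"
proof -
  obtain n \<rho> where irr: "irreducible_representation G n \<rho>" and \<chi>': "\<chi> = character_of G \<rho>"
    using assms by (rule IrrE)
  note rep = irreducible_representationD(1,2)[OF irr]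
  show ?thesis using that[OF rep(2)] representationD(2)[OF rep(1)] by (simp add: \<chi>' character_of_def)
qed

lemma Irr_degree_nonzero: "\<chi> \<in> Irr G \<Longrightarrow> \<chi> \<one> \<noteq> 0"
  by (erule Irr_degree) simp

text \<open>The average of \<open>\<rho> g\<close> is the scalar \<open>|G| \<chi>(g) / \<chi>(1)\<close>; multiply by \<open>\<rho> h\<close> and take the trace.\<close>

lemma Irr_conj_product:
  assumes \<chi>: "\<chi> \<in> Irr G" and g: "g \<in> carrier G" and h: "h \<in> carrier G"
  shows "(\<Sum>x\<in>carrier G. \<chi> \<one> * \<chi> (h \<otimes> (x \<otimes> g \<otimes> inv x))) = of_nat (card (carrier G)) * (\<chi> h * \<chi> g)"
proof -
  obtain n \<rho> where irr: "irreducible_representation G n \<rho>" and \<chi>': "\<chi> = character_of G \<rho>"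
    using \<chi> by (rule IrrE)
  note rep = irreducible_representationD(1,2)[OF irr]
  note \<rho> = representationD[OF rep(1)]
  have one: "\<chi> \<one> = of_nat n" using \<rho>(2) by (simp add: \<chi>' character_of_def)
  let ?c = "of_nat (card (carrier G)) * mat_trace (\<rho> g) / of_nat n"
  have F: "\<rho> x * \<rho> g * \<rho> (inv x) \<in> carrier_mat n n" if "x \<in> carrier G" for x
    using \<rho>(1)[OF that] \<rho>(1)[OF g] \<rho>(1)[OF inv_closed[OF that]] by simp
  have "(\<Sum>x\<in>carrier G. \<chi> (h \<otimes> (x \<otimes> g \<otimes> inv x))) =
      (\<Sum>x\<in>carrier G. mat_trace (\<rho> h * (\<rho> x * \<rho> g * \<rho> (inv x))))"
    using g h by (intro sum.cong refl) (simp add: \<chi>' character_of_def \<rho>(3))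
  also have "\<dots> = mat_trace (mat_sum n n (\<lambda>x. \<rho> h * (\<rho> x * \<rho> g * \<rho> (inv x))) (carrier G))"
    using F \<rho>(1)[OF h] by (intro mat_trace_mat_sum[symmetric]) auto
  also have "mat_sum n n (\<lambda>x. \<rho> h * (\<rho> x * \<rho> g * \<rho> (inv x))) (carrier G) = \<rho> h * group_average n n \<rho> \<rho> (\<rho> g)"
    unfolding group_average_def using F \<rho>(1)[OF h] by (intro mult_mat_sum[symmetric]) auto
  also have "\<dots> = ?c \<cdot>\<^sub>m \<rho> h"
    unfolding group_average_scalar[OF irr \<rho>(1)[OF g]]
    using \<rho>(1)[OF h] by (simp add: mult_smult_distrib[of _ n n _ n])
  also have "mat_trace \<dots> = ?c * mat_trace (\<rho> h)"
    by (rule mat_trace_smult[OF \<rho>(1)[OF h]])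
  finally show ?thesis using rep(2) g h
    by (simp add: \<rho>(2) \<chi>' character_of_def flip: sum_distrib_left)
qed

section \<open>Decomposition of characters\<close>

text \<open>With \<open>Q * P\<close> the projection onto a subspace, the hypothesis covers both the restriction to an
invariant subspace (the first alternative) and the action on the quotient by an
invariant subspace, realised on a complement (the second alternative).\<close>

lemma representation_compression:
  assumes \<rho>: "representation G n \<rho>" and P: "P \<in> carrier_mat r n" and Q: "Q \<in> carrier_mat n r"
    and PQ: "P * Q = 1\<^sub>m r"
    and inv: "(\<forall>g\<in>carrier G. (Q * P) * (\<rho> g * Q) = \<rho> g * Q) \<or> (\<forall>g\<in>carrier G. (P * \<rho> g) * (Q * P) = P * \<rho> g)"
  shows "representation G r (\<lambda>g. P * \<rho> g * Q)"
    and "g \<in> carrier G \<Longrightarrow> mat_trace (P * \<rho> g * Q) = mat_trace (\<rho> g * (Q * P))"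
proof -
  note \<rho>' = representationD[OF \<rho>]
  have mult: "P * \<rho> (g \<otimes> h) * Q = (P * \<rho> g * Q) * (P * \<rho> h * Q)"
    if g: "g \<in> carrier G" and h: "h \<in> carrier G" for g h
  proof -
    note c = \<rho>'(1)[OF g] \<rho>'(1)[OF h]
    have Pg: "P * \<rho> g \<in> carrier_mat r n" and hQ: "\<rho> h * Q \<in> carrier_mat n r"
      and QP: "Q * P \<in> carrier_mat n n" using P Q c by auto
    have "P * \<rho> (g \<otimes> h) * Q = (P * \<rho> g) * (\<rho> h * Q)"
      unfolding \<rho>'(3)[OF g h] assoc_mult_mat[OF P c, symmetric] by (rule assoc_mult_mat[OF Pg c(2) Q])
    also have "\<dots> = (P * \<rho> g) * ((Q * P) * (\<rho> h * Q))"
      using inv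
    proof
      assume "\<forall>g\<in>carrier G. (P * \<rho> g) * (Q * P) = P * \<rho> g"
      then show ?thesis using g unfolding assoc_mult_mat[OF Pg QP hQ, symmetric] by simp
    qed (use h in simp)
    also have "(Q * P) * (\<rho> h * Q) = Q * (P * \<rho> h * Q)"
      unfolding assoc_mult_mat[OF Q P hQ] assoc_mult_mat[OF P c(2) Q] ..
    also have "(P * \<rho> g) * \<dots> = (P * \<rho> g * Q) * (P * \<rho> h * Q)"
      by (rule assoc_mult_mat[OF Pg Q, symmetric]) (use P Q c in auto)
    finally show ?thesis .
  qed
  have "P * \<rho> \<one> * Q = 1\<^sub>m r" unfolding \<rho>'(2) right_mult_one_mat[OF P] by (rule PQ)
  then show "representation G r (\<lambda>g. P * \<rho> g * Q)"
    unfolding representation_iff using mult \<rho>'(1) P Q by auto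
  assume g: "g \<in> carrier G"
  have "mat_trace (P * \<rho> g * Q) = mat_trace (P * (\<rho> g * Q))"
    unfolding assoc_mult_mat[OF P \<rho>'(1)[OF g] Q] ..
  also have "\<dots> = mat_trace ((\<rho> g * Q) * P)"
    by (rule mat_trace_mult_comm[OF P]) (use \<rho>'(1)[OF g] Q in auto)
  also have "(\<rho> g * Q) * P = \<rho> g * (Q * P)" by (rule assoc_mult_mat[OF \<rho>'(1)[OF g] Q P])
  finally show "mat_trace (P * \<rho> g * Q) = mat_trace (\<rho> g * (Q * P))" .
qed

text \<open>The character of a representation is the sum of those of an invariant subspace and of the
quotient by it. Here \<open>E\<close> is a projection onto the subspace \<open>W\<close>, and the quotient is realised
on the image \<open>W'\<close> of the complementary projection \<open>E'\<close>; the complement \<open>W'\<close> is in general not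
invariant.\<close>

lemma representation_character_splits:
  assumes \<rho>: "representation G n \<rho>"
    and W: "VectorSpace.subspace class_ring W (module_vec TYPE(complex) n)"
    and inv: "\<And>g w. g \<in> carrier G \<Longrightarrow> w \<in> W \<Longrightarrow> \<rho> g *\<^sub>v w \<in> W"
    and W0: "W \<noteq> {0\<^sub>v n}" and W1: "W \<noteq> carrier_vec n"
  obtains r \<rho>1 s \<rho>2 where "r < n" "s < n" "representation G r \<rho>1" "representation G s \<rho>2"
    "\<And>g. g \<in> carrier G \<Longrightarrow> mat_trace (\<rho> g) = mat_trace (\<rho>1 g) + mat_trace (\<rho>2 g)"
proof -
  note \<rho>' = representationD[OF \<rho>]
  obtain r B C where B: "B \<in> carrier_mat n r" and C: "C \<in> carrier_mat r n" and CB: "C * B = 1\<^sub>m r"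
    and colB: "\<And>j. j < r \<Longrightarrow> col B j \<in> W" and BCw: "\<And>w. w \<in> W \<Longrightarrow> B *\<^sub>v (C *\<^sub>v w) = w"
    using subspace_projection[OF W] by metis
  define E where "E = B * C"
  define E' where "E' = 1\<^sub>m n + (- 1) \<cdot>\<^sub>m E"
  have E: "E \<in> carrier_mat n n" and E': "E' \<in> carrier_mat n n" using B C by (auto simp: E_def E'_def)
  have Ew: "E *\<^sub>v w = w" if "w \<in> W" for w
    using BCw[OF that] assoc_mult_mat_vec[OF B C, of w] W that by (auto simp: E_def subspace_vec_iff)
  have EX: "E * X = X" if X: "X \<in> carrier_mat n k" and cols: "\<And>j. j < k \<Longrightarrow> col X j \<in> W" for X k
    by (rule mult_mat_eqI[OF E X X]) (rule Ew[OF cols])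
  have EW: "E *\<^sub>v v \<in> W" if v: "v \<in> carrier_vec n" for v
    unfolding E_def assoc_mult_mat_vec[OF B C v]
    using C v by (intro subspace_mult_mat_vec[OF W B colB]) auto
  have colE: "col E j \<in> W" if "j < n" for j
    unfolding E_def col_mult_mat[OF B C that]
    using C that by (intro subspace_mult_mat_vec[OF W B colB]) auto
  have EE: "E * E = E" using EX[OF E colE] .
  have E'X: "E' * X = X + (- 1) \<cdot>\<^sub>m (E * X)" if X: "X \<in> carrier_mat n k" for X k
    unfolding E'_def using E X
    by (subst add_mult_distrib_mat[of _ n n]) (auto simp: mult_smult_assoc_mat[of _ n n _ k])
  have XE': "X * E' = X + (- 1) \<cdot>\<^sub>m (X * E)" if X: "X \<in> carrier_mat k n" for X k
    unfolding E'_def using E X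
    by (subst mult_add_distrib_mat[of _ k n]) (auto simp: mult_smult_distrib[of _ k n _ n])
  have cancel: "X + (- 1) \<cdot>\<^sub>m X = 0\<^sub>m k l" if "X \<in> carrier_mat k l" for X :: "complex mat" and k l
    using that by (auto intro!: eq_matI)
  have EE': "E * E' = 0\<^sub>m n n" and E'E: "E' * E = 0\<^sub>m n n"
    unfolding XE'[OF E] E'X[OF E] EE by (rule cancel[OF E])+

  define W' where "W' = {v \<in> carrier_vec n. E *\<^sub>v v = 0\<^sub>v n}"
  have W': "VectorSpace.subspace class_ring W' (module_vec TYPE(complex) n)"
    using E by (auto simp: subspace_vec_iff W'_def mult_add_distrib_mat_vec mult_mat_vec)
  obtain s B' C' where B': "B' \<in> carrier_mat n s" and C': "C' \<in> carrier_mat s n" and CB': "C' * B' = 1\<^sub>m s"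
    and colB': "\<And>j. j < s \<Longrightarrow> col B' j \<in> W'" and BCw': "\<And>w. w \<in> W' \<Longrightarrow> B' *\<^sub>v (C' *\<^sub>v w) = w"
    using subspace_projection[OF W'] by metis
  \<comment> \<open>\<open>C\'\<close> is adjusted so that it vanishes on \<open>W\<close> and still inverts \<open>B\'\<close> from the left.\<close>
  define D where "D = C' * E'"
  have D: "D \<in> carrier_mat s n" using C' E' by (simp add: D_def)
  have "E * B' = 0\<^sub>m n s"
    by (rule mult_mat_eqI[OF E B']) (use colB' in \<open>auto simp: W'_def\<close>)
  then have E'B': "E' * B' = B'" unfolding E'X[OF B'] using B' by (auto intro!: eq_matI)
  have DB': "D * B' = 1\<^sub>m s" unfolding D_def assoc_mult_mat[OF C' E' B'] E'B' by (rule CB')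
  have colE': "col E' j \<in> W'" if j: "j < n" for j
  proof -
    have "E *\<^sub>v col E' j = col (0\<^sub>m n n) j" unfolding col_mult_mat[OF E E' j, symmetric] EE' ..
    then show ?thesis using E' j by (simp add: W'_def)
  qed
  have "(B' * C') * E' = E'"
  proof (rule mult_mat_eqI[OF mult_carrier_mat[OF B' C'] E' E'])
    fix j assume j: "j < n"
    have "col E' j \<in> carrier_vec n" using E' j by simp
    then show "(B' * C') *\<^sub>v col E' j = col E' j"
      unfolding assoc_mult_mat_vec[OF B' C' \<open>col E' j \<in> carrier_vec n\<close>] by (intro BCw' colE' j)
  qed
  then have B'D: "B' * D = E'" unfolding D_def assoc_mult_mat[OF B' C' E'] .
  have DE: "D * E = 0\<^sub>m s n" unfolding D_def assoc_mult_mat[OF C' E' E] E'E using C' by simp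

  have \<rho>E: "E * (\<rho> g * X) = \<rho> g * X" if g: "g \<in> carrier G" and X: "X \<in> carrier_mat n k"
    and cols: "\<And>j. j < k \<Longrightarrow> col X j \<in> W" for g X k
  proof (rule EX[OF mult_carrier_mat[OF \<rho>'(1)[OF g] X]])
    fix j assume "j < k"
    then show "col (\<rho> g * X) j \<in> W"
      unfolding col_mult_mat[OF \<rho>'(1)[OF g] X \<open>j < k\<close>] by (intro inv g cols)
  qed
  have inv1: "\<forall>g\<in>carrier G. (B * C) * (\<rho> g * B) = \<rho> g * B"
    using \<rho>E[OF _ B colB] by (simp add: E_def)
  have inv2: "\<forall>g\<in>carrier G. (D * \<rho> g) * (B' * D) = D * \<rho> g"
  proof
    fix g assume g: "g \<in> carrier G"
    note c = \<rho>'(1)[OF g]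
    have c': "\<rho> g * E \<in> carrier_mat n n" "D * \<rho> g \<in> carrier_mat s n" using c D E by auto
    have "(D * \<rho> g) * E = D * (\<rho> g * E)" by (rule assoc_mult_mat[OF D c E])
    also have "\<dots> = (D * E) * (\<rho> g * E)"
      using \<rho>E[OF g E colE] by (simp add: assoc_mult_mat[OF D E c'(1)])
    also have "\<dots> = 0\<^sub>m s n" unfolding DE by (rule left_mult_zero_mat[OF c'(1)])
    finally show "(D * \<rho> g) * (B' * D) = D * \<rho> g"
      unfolding B'D XE'[OF c'(2)] using c' by (auto intro!: eq_matI)
  qed
  note rep1 = representation_compression[OF \<rho> C B CB disjI1[OF inv1]]
  note rep2 = representation_compression[OF \<rho> D B' DB' disjI2[OF inv2]]
  have tr: "mat_trace (\<rho> g) = mat_trace (C * \<rho> g * B) + mat_trace (D * \<rho> g * B')" if g: "g \<in> carrier G" for g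
  proof -
    note c = \<rho>'(1)[OF g]
    have c': "\<rho> g * E \<in> carrier_mat n n" using c E by auto
    have "mat_trace (D * \<rho> g * B') = mat_trace (\<rho> g) + (- 1) * mat_trace (\<rho> g * E)"
      unfolding rep2(2)[OF g] B'D XE'[OF c] using c c'
      by (subst mat_trace_add[of _ n]) (auto simp: mat_trace_smult[of _ n])
    moreover have "mat_trace (C * \<rho> g * B) = mat_trace (\<rho> g * E)"
      unfolding rep1(2)[OF g] E_def ..
    ultimately show ?thesis by simp
  qed
  \<comment> \<open>The traces at the unit element give the dimensions.\<close>
  have "(of_nat n :: complex) = of_nat (r + s)"
    using tr[OF one_closed] representationD(2)[OF rep1(1)] representationD(2)[OF rep2(1)] by (simp add: \<rho>'(2))
  then have nrs: "n = r + s" using of_nat_eq_iff by blast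
  have "r \<noteq> 0"
  proof
    assume "r = 0"
    then have "E = 0\<^sub>m n n" unfolding E_def using B C by (intro mult_mat_inner_dim_0) auto
    have "w = 0\<^sub>v n" if w: "w \<in> W" for w
    proof -
      have "w \<in> carrier_vec n" using W w by (auto simp: subspace_vec_iff)
      then have "0\<^sub>m n n *\<^sub>v w = 0\<^sub>v n" by (intro eq_vecI) auto
      then show ?thesis using Ew[OF w] \<open>E = 0\<^sub>m n n\<close> by simp
    qed
    moreover have "0\<^sub>v n \<in> W" using W by (simp add: subspace_vec_iff)
    ultimately show False using W0 by blast
  qed
  have "s \<noteq> 0"
  proof
    assume "s = 0"
    then have "r = n" using nrs by simp
    have "E' = 0\<^sub>m n n" unfolding B'D[symmetric] using \<open>s = 0\<close> B' D by (intro mult_mat_inner_dim_0) auto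
    then have *: "1\<^sub>m n + (- 1) \<cdot>\<^sub>m E = 0\<^sub>m n n" by (simp add: E'_def)
    have "E = 1\<^sub>m n"
    proof (rule eq_matI)
      fix i j assume "i < dim_row (1\<^sub>m n :: complex mat)" "j < dim_col (1\<^sub>m n :: complex mat)"
      then show "E $$ (i, j) = 1\<^sub>m n $$ (i, j)"
        using E arg_cong[OF *, of "\<lambda>A. A $$ (i, j)"] by simp
    qed (use E in auto)
    then have "carrier_vec n \<subseteq> W" using EW by auto
    then show False using W1 W by (auto simp: subspace_vec_iff)
  qed
  show ?thesis
    using that[OF _ _ rep1(1) rep2(1) tr] \<open>r \<noteq> 0\<close> \<open>s \<noteq> 0\<close> nrs by simp
qed

lemma representation_character_decomposes:
  assumes "representation G n \<rho>"
  shows "\<exists>M. set_mset M \<subseteq> Irr G \<and> (\<forall>g\<in>carrier G. mat_trace (\<rho> g) = (\<Sum>\<chi>\<in>#M. \<chi> g))"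
  using assms
proof (induction n arbitrary: \<rho> rule: less_induct)
  case (less n)
  consider "n = 0" | "irreducible_representation G n \<rho>" | "n > 0" "\<not> irreducible_representation G n \<rho>" by blast
  then show ?case
  proof cases
    case 1
    then have "mat_trace (\<rho> g) = 0" if "g \<in> carrier G" for g
      using representationD(1)[OF less.prems that] by (simp add: mat_trace_def)
    then show ?thesis by (intro exI[of _ "{#}"]) simp
  next
    case 2
    then have "character_of G \<rho> \<in> Irr G" by (auto simp: Irr_def)
    then show ?thesis by (intro exI[of _ "{#character_of G \<rho>#}"]) (simp add: character_of_def)
  next
    case 3
    then obtain W where W: "VectorSpace.subspace class_ring W (module_vec TYPE(complex) n)"
      "\<And>g w. g \<in> carrier G \<Longrightarrow> w \<in> W \<Longrightarrow> \<rho> g *\<^sub>v w \<in> W" "W \<noteq> {0\<^sub>v n}" "W \<noteq> carrier_vec n"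
      using less.prems by (auto simp: irreducible_representation_def)
    obtain r \<rho>1 s \<rho>2 where *: "r < n" "s < n" "representation G r \<rho>1" "representation G s \<rho>2"
      "\<And>g. g \<in> carrier G \<Longrightarrow> mat_trace (\<rho> g) = mat_trace (\<rho>1 g) + mat_trace (\<rho>2 g)"
      using representation_character_splits[OF less.prems W] by metis
    obtain M1 M2 where M: "set_mset M1 \<subseteq> Irr G" "set_mset M2 \<subseteq> Irr G"
      "\<forall>g\<in>carrier G. mat_trace (\<rho>1 g) = (\<Sum>\<chi>\<in>#M1. \<chi> g)"
      "\<forall>g\<in>carrier G. mat_trace (\<rho>2 g) = (\<Sum>\<chi>\<in>#M2. \<chi> g)"
      using less.IH[OF *(1,3)] less.IH[OF *(2,4)] by blast
    then show ?thesis using *(5) by (intro exI[of _ "M1 + M2"]) simp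
  qed
qed

end

lemma sum_mset_eq_sum_count:
  assumes "finite S" "set_mset M \<subseteq> S"
  shows "(\<Sum>x\<in>#M. f x) = (\<Sum>x\<in>S. of_nat (count M x) * (f x :: complex))"
  using assms(2)
proof (induction M)
  case (add y M)
  have "(\<Sum>x\<in>S. of_nat (count (add_mset y M) x) * f x) =
      (\<Sum>x\<in>S. (if x = y then f y else 0) + of_nat (count M x) * f x)"
    by (intro sum.cong refl) (auto simp: algebra_simps)
  then show ?case using add assms(1) by (simp add: sum.distrib)
qed simp

section \<open>Second orthogonality relation\<close>

context finite_group begin

text \<open>By orthogonality the members of \<open>M\<close> other than \<open>\<chi>\<close> contribute \<open>0\<close>.\<close>

lemma multiplicity_eq_count:
  assumes "set_mset M \<subseteq> Irr G" and \<chi>: "\<chi> \<in> Irr G"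
  shows "(\<Sum>g\<in>carrier G. (\<Sum>\<psi>\<in>#M. \<psi> g) * \<chi> (inv g)) = of_nat (card (carrier G)) * of_nat (count M \<chi>)"
  using assms(1)
proof (induction M)
  case (add \<psi> M)
  have "(\<Sum>g\<in>carrier G. (\<Sum>\<phi>\<in>#add_mset \<psi> M. \<phi> g) * \<chi> (inv g)) =
      (\<Sum>g\<in>carrier G. \<psi> g * \<chi> (inv g)) + (\<Sum>g\<in>carrier G. (\<Sum>\<phi>\<in>#M. \<phi> g) * \<chi> (inv g))"
    by (simp add: distrib_right sum.distrib)
  then show ?case using add first_orthogonality[OF _ \<chi>, of \<psi>] by (simp add: algebra_simps)
qed simp

lemma card_carrier_nonzero: "of_nat (card (carrier G)) \<noteq> (0 :: complex)"
  using one_closed finite_carrier by (metis card_0_eq empty_iff of_nat_eq_0_iff)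

text \<open>The action of the group on itself by left multiplication, as permutation matrices with respect to an
enumeration \<open>e\<close> of the elements; only the unit element has fixed points.\<close>

lemma regular_representation:
  obtains \<rho> where "representation G (card (carrier G)) \<rho>"
    "\<And>g. g \<in> carrier G \<Longrightarrow> mat_trace (\<rho> g) = (if g = \<one> then of_nat (card (carrier G)) else 0)"
proof -
  let ?N = "card (carrier G)"
  obtain e where e: "bij_betw e {..<?N} (carrier G)"
    using ex_bij_betw_nat_finite[OF finite_carrier] by (auto simp: atLeast0LessThan)
  have eG: "e i \<in> carrier G" if "i < ?N" for i using e that by (auto simp: bij_betw_def)
  have inj: "e i = e j \<longleftrightarrow> i = j" if "i < ?N" "j < ?N" for i j
    using e that by (auto simp: bij_betw_def inj_on_def)
  define \<rho> :: "'a \<Rightarrow> complex mat" where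
    "\<rho> g = mat ?N ?N (\<lambda>(i, j). if e i = g \<otimes> e j then 1 else 0)" for g
  have car: "\<rho> g \<in> carrier_mat ?N ?N" for g by (simp add: \<rho>_def)
  have "\<rho> (g \<otimes> h) = \<rho> g * \<rho> h" if g: "g \<in> carrier G" and h: "h \<in> carrier G" for g h
  proof (rule eq_matI)
    fix i j assume "i < dim_row (\<rho> g * \<rho> h)" "j < dim_col (\<rho> g * \<rho> h)"
    then have ij: "i < ?N" "j < ?N" by (auto simp: \<rho>_def)
    obtain l where l: "l < ?N" "e l = h \<otimes> e j"
      using e h eG[OF ij(2)] by (metis bij_betw_imp_surj_on imageE lessThan_iff m_closed)
    have "(\<rho> g * \<rho> h) $$ (i, j) = (\<Sum>k<?N. \<rho> g $$ (i, k) * \<rho> h $$ (k, j))"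
      by (rule index_mult_mat_sum[OF car car ij])
    also have "\<dots> = (\<Sum>k<?N. if k = l then (if e i = g \<otimes> e l then 1 else 0) else 0)"
      using ij by (intro sum.cong refl) (auto simp: \<rho>_def inj l simp flip: l(2))
    also have "\<dots> = \<rho> (g \<otimes> h) $$ (i, j)"
      using ij l g h eG[OF ij(2)] by (simp add: \<rho>_def m_assoc)
    finally show "\<rho> (g \<otimes> h) $$ (i, j) = (\<rho> g * \<rho> h) $$ (i, j)" ..
  qed (simp_all add: \<rho>_def)
  moreover have "\<rho> \<one> = 1\<^sub>m ?N"
    using eG inj by (auto simp: \<rho>_def intro!: eq_matI)
  ultimately have "representation G ?N \<rho>" using car by (simp add: representation_iff)
  moreover have "mat_trace (\<rho> g) = (if g = \<one> then of_nat ?N else 0)" if "g \<in> carrier G" for g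
  proof -
    have "e i = g \<otimes> e i \<longleftrightarrow> g = \<one>" if "i < ?N" for i
      using eG[OF that] \<open>g \<in> carrier G\<close> by (metis l_one one_closed right_cancel)
    then show ?thesis by (simp add: mat_trace_def \<rho>_def)
  qed
  ultimately show ?thesis using that by blast
qed

text \<open>The regular character vanishes off the unit element, so its inner product with \<open>\<chi>\<close> is \<open>|G| \<chi>(1)\<close>, and
hence \<open>\<chi>\<close> occurs with multiplicity \<open>\<chi>(1)\<close>. In particular each irreducible character is a member of
one finite multiset.\<close>

lemma finite_Irr: "finite (Irr G)"
  and regular_character:
    "g \<in> carrier G \<Longrightarrow> (\<Sum>\<chi>\<in>Irr G. \<chi> \<one> * \<chi> g) = (if g = \<one> then of_nat (card (carrier G)) else 0)"
proof -
  obtain \<rho> where \<rho>: "representation G (card (carrier G)) \<rho>"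
    "\<And>g. g \<in> carrier G \<Longrightarrow> mat_trace (\<rho> g) = (if g = \<one> then of_nat (card (carrier G)) else 0)"
    using regular_representation by blast
  obtain M where M: "set_mset M \<subseteq> Irr G"
    and tr: "\<And>g. g \<in> carrier G \<Longrightarrow> (\<Sum>\<chi>\<in>#M. \<chi> g) = (if g = \<one> then of_nat (card (carrier G)) else 0)"
    using representation_character_decomposes[OF \<rho>(1)] \<rho>(2) by metis
  have count: "of_nat (count M \<chi>) = \<chi> \<one>" if \<chi>: "\<chi> \<in> Irr G" for \<chi>
  proof -
    have "of_nat (card (carrier G)) * of_nat (count M \<chi>) =
        (\<Sum>g\<in>carrier G. (if g = \<one> then of_nat (card (carrier G)) * \<chi> \<one> else 0))"
      unfolding multiplicity_eq_count[OF M \<chi>, symmetric] by (intro sum.cong refl) (simp add: tr)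
    then show ?thesis using card_carrier_nonzero by simp
  qed
  have "\<chi> \<in># M" if "\<chi> \<in> Irr G" for \<chi>
    using count[OF that] Irr_degree_nonzero[OF that] by (metis count_eq_zero_iff of_nat_0)
  then have "Irr G \<subseteq> set_mset M" by blast
  then show fin: "finite (Irr G)" by (rule finite_subset) simp
  assume g: "g \<in> carrier G"
  have "(\<Sum>\<chi>\<in>Irr G. \<chi> \<one> * \<chi> g) = (\<Sum>\<chi>\<in>#M. \<chi> g)"
    unfolding sum_mset_eq_sum_count[OF fin M] by (intro sum.cong refl) (simp add: count)
  then show "(\<Sum>\<chi>\<in>Irr G. \<chi> \<one> * \<chi> g) = (if g = \<one> then of_nat (card (carrier G)) else 0)"
    using tr[OF g] by simp
qed

text \<open>By \<open>Irr_conj_product\<close> the sum is, up to the factor \<open>|G|\<close>, the sum of the regular character over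
the products of \<open>h\<close> with the conjugates of \<open>inv g\<close>, and it counts the products equal to the unit. The
right-hand side is the order of the centraliser of \<open>g\<close> if \<open>h\<close> is conjugate to \<open>g\<close>, and \<open>0\<close> otherwise.\<close>

theorem second_orthogonality:
  assumes g: "g \<in> carrier G" and h: "h \<in> carrier G"
  shows "(\<Sum>\<chi>\<in>Irr G. \<chi> h * \<chi> (inv g)) = of_nat (card {x \<in> carrier G. x \<otimes> g \<otimes> inv x = h})"
proof -
  let ?N = "of_nat (card (carrier G)) :: complex"
  have conj: "h \<otimes> (x \<otimes> inv g \<otimes> inv x) = \<one> \<longleftrightarrow> x \<otimes> g \<otimes> inv x = h" if x: "x \<in> carrier G" for x
  proof -
    have "x \<otimes> inv g \<otimes> inv x = inv (x \<otimes> g \<otimes> inv x)"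
      using x g by (simp add: inv_mult_group m_assoc)
    then show ?thesis using x g h
      by (metis inv_closed inv_equality inv_inv m_closed r_inv)
  qed
  have "?N * (\<Sum>\<chi>\<in>Irr G. \<chi> h * \<chi> (inv g)) =
      (\<Sum>\<chi>\<in>Irr G. \<Sum>x\<in>carrier G. \<chi> \<one> * \<chi> (h \<otimes> (x \<otimes> inv g \<otimes> inv x)))"
    unfolding sum_distrib_left using g h by (intro sum.cong refl Irr_conj_product[symmetric]) auto
  also have "\<dots> = (\<Sum>x\<in>carrier G. \<Sum>\<chi>\<in>Irr G. \<chi> \<one> * \<chi> (h \<otimes> (x \<otimes> inv g \<otimes> inv x)))"
    by (rule sum.swap)
  also have "\<dots> = (\<Sum>x\<in>carrier G. if x \<otimes> g \<otimes> inv x = h then ?N else 0)"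
    using g h by (intro sum.cong refl) (simp add: regular_character conj)
  also have "\<dots> = (\<Sum>x\<in>{x \<in> carrier G. x \<otimes> g \<otimes> inv x = h}. ?N)"
    by (rule sum.inter_filter[symmetric]) simp
  finally show ?thesis using card_carrier_nonzero by simp
qed

text \<open>The conjugate transposes of the matrices \<open>\<rho> (inv h)\<close> form a representation \<open>\<rho>'\<close> with character
\<open>cnj (\<chi> (inv h))\<close>. Its inner product with \<open>\<chi>\<close> is a sum of squares and positive, so \<open>\<chi>\<close> is a
constituent. As the degrees agree, it is the only one.\<close>

lemma Irr_inv_eq_cnj:
  assumes \<chi>: "\<chi> \<in> Irr G" and g: "g \<in> carrier G"
  shows "\<chi> (inv g) = cnj (\<chi> g)"
proof -
  obtain n \<rho> where irr: "irreducible_representation G n \<rho>" and \<chi>': "\<chi> = character_of G \<rho>"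
    using \<chi> by (rule IrrE)
  note rep = irreducible_representationD(1,2)[OF irr]
  note \<rho> = representationD[OF rep(1)]
  define \<rho>' where "\<rho>' h = mat n n (\<lambda>(i, j). cnj (\<rho> (inv h) $$ (j, i)))" for h
  have car: "\<rho>' h \<in> carrier_mat n n" for h by (simp add: \<rho>'_def)
  have "\<rho>' (h \<otimes> k) = \<rho>' h * \<rho>' k" if h: "h \<in> carrier G" and k: "k \<in> carrier G" for h k
  proof (rule eq_matI)
    fix i j assume "i < dim_row (\<rho>' h * \<rho>' k)" "j < dim_col (\<rho>' h * \<rho>' k)"
    then have ij: "i < n" "j < n" by (auto simp: \<rho>'_def)
    have "\<rho>' (h \<otimes> k) $$ (i, j) = cnj ((\<rho> (inv k) * \<rho> (inv h)) $$ (j, i))"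
      using ij h k by (simp add: \<rho>'_def inv_mult_group \<rho>(3))
    also have "\<dots> = (\<Sum>l<n. \<rho>' h $$ (i, l) * \<rho>' k $$ (l, j))"
      unfolding index_mult_mat_sum[OF \<rho>(1)[OF inv_closed[OF k]] \<rho>(1)[OF inv_closed[OF h]] ij(2,1)]
      using ij by (auto simp: \<rho>'_def mult.commute intro!: sum.cong)
    also have "\<dots> = (\<rho>' h * \<rho>' k) $$ (i, j)"
      by (rule index_mult_mat_sum[OF car car ij, symmetric])
    finally show "\<rho>' (h \<otimes> k) $$ (i, j) = (\<rho>' h * \<rho>' k) $$ (i, j)" .
  qed (simp_all add: \<rho>'_def)
  moreover have "\<rho>' \<one> = 1\<^sub>m n" by (auto simp: \<rho>'_def \<rho>(2) intro!: eq_matI)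
  ultimately have rep': "representation G n \<rho>'" using car by (simp add: representation_iff)
  have tr: "mat_trace (\<rho>' h) = cnj (\<chi> (inv h))" if h: "h \<in> carrier G" for h
    using h carrier_matD[OF \<rho>(1)[OF inv_closed[OF h]]]
    by (simp add: \<chi>' character_of_def mat_trace_def \<rho>'_def)
  obtain M where M: "set_mset M \<subseteq> Irr G"
    and trM: "\<And>h. h \<in> carrier G \<Longrightarrow> (\<Sum>\<psi>\<in>#M. \<psi> h) = cnj (\<chi> (inv h))"
    using representation_character_decomposes[OF rep'] tr by metis
  have "\<chi> \<in># M"
  proof (rule ccontr)
    assume "\<chi> \<notin># M"
    then have "(\<Sum>h\<in>carrier G. cnj (\<chi> (inv h)) * \<chi> (inv h)) = 0"
      using multiplicity_eq_count[OF M \<chi>] trM by (simp add: not_in_iff)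
    then have "of_real (\<Sum>h\<in>carrier G. (cmod (\<chi> (inv h)))\<^sup>2) = (0 :: complex)"
      by (simp add: complex_norm_square mult.commute del: of_real_power)
    then have "(\<Sum>h\<in>carrier G. (cmod (\<chi> (inv h)))\<^sup>2) = 0" by (simp only: of_real_eq_0_iff)
    then have "\<forall>h\<in>carrier G. \<chi> (inv h) = 0" by (subst (asm) sum_nonneg_eq_0_iff) auto
    then have "\<chi> (inv \<one>) = 0" by blast
    then show False using Irr_degree_nonzero[OF \<chi>] by simp
  qed
  then obtain M' where M': "M = add_mset \<chi> M'" by (metis insert_DiffM)
  have "(\<Sum>\<psi>\<in>#M'. \<psi> \<one>) = 0"
    using trM[of \<one>] \<chi> by (auto simp: M' elim: Irr_degree)
  have "M' = {#}"
  proof (rule ccontr)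
    assume "M' \<noteq> {#}"
    have "set_mset N \<subseteq> Irr G \<Longrightarrow> \<exists>k. (\<Sum>\<psi>\<in>#N. \<psi> \<one>) = of_nat k \<and> size N \<le> k" for N
    proof (induction N)
      case (add \<psi> N)
      then obtain k where "(\<Sum>\<psi>\<in>#N. \<psi> \<one>) = of_nat k" "size N \<le> k" by auto
      moreover obtain d where "d > 0" "\<psi> \<one> = of_nat d" using add.prems by (auto elim: Irr_degree)
      ultimately show ?case by (intro exI[of _ "d + k"]) auto
    qed simp
    from this[of M'] obtain k where "(\<Sum>\<psi>\<in>#M'. \<psi> \<one>) = of_nat k" "size M' \<le> k" using M M' by auto
    then show False using \<open>(\<Sum>\<psi>\<in>#M'. \<psi> \<one>) = 0\<close> \<open>M' \<noteq> {#}\<close> by simp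
  qed
  then have "\<chi> g = cnj (\<chi> (inv g))" using trM[OF g] M' by simp
  then show ?thesis by simp
qed

end

section \<open>Partitions of finite sets\<close>

text \<open>The hypothesis says \<open>a * b = 1\<close> for matrices indexed by finite sets; enumerating the index
sets reduces both claims to matrices indexed by numbers.\<close>

lemma card_le_if_left_inverse:
  fixes a :: "'s \<Rightarrow> 't \<Rightarrow> 'f::field" and b :: "'t \<Rightarrow> 's \<Rightarrow> 'f"
  assumes S: "finite S" and T: "finite T"
    and ab: "\<And>s s'. s \<in> S \<Longrightarrow> s' \<in> S \<Longrightarrow> (\<Sum>t\<in>T. a s t * b t s') = of_bool (s = s')"
  shows "card S \<le> card T"
    and "card S = card T \<Longrightarrow> t \<in> T \<Longrightarrow> t' \<in> T \<Longrightarrow> (\<Sum>s\<in>S. b t s * a s t') = of_bool (t = t')"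
proof -
  obtain e where e: "bij_betw e {0..<card S} S" using ex_bij_betw_nat_finite[OF S] by blast
  obtain f where f: "bij_betw f {0..<card T} T" using ex_bij_betw_nat_finite[OF T] by blast
  have eS: "e i \<in> S" if "i < card S" for i using e that by (auto simp: bij_betw_def)
  have fT: "f i \<in> T" if "i < card T" for i using f that by (auto simp: bij_betw_def)
  have einj: "e i = e j \<longleftrightarrow> i = j" if "i < card S" "j < card S" for i j
    using e that by (auto simp: bij_betw_def inj_on_def)
  have finj: "f i = f j \<longleftrightarrow> i = j" if "i < card T" "j < card T" for i j
    using f that by (auto simp: bij_betw_def inj_on_def)
  define M where "M = mat (card S) (card T) (\<lambda>(i, j). a (e i) (f j))"
  define N where "N = mat (card T) (card S) (\<lambda>(j, i). b (f j) (e i))"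
  have M: "M \<in> carrier_mat (card S) (card T)" and N: "N \<in> carrier_mat (card T) (card S)"
    by (simp_all add: M_def N_def)
  have MN: "M * N = 1\<^sub>m (card S)"
  proof (rule eq_matI)
    fix i j assume "i < dim_row (1\<^sub>m (card S) :: 'f mat)" "j < dim_col (1\<^sub>m (card S) :: 'f mat)"
    then have ij: "i < card S" "j < card S" by auto
    have "(M * N) $$ (i, j) = (\<Sum>k = 0..<card T. a (e i) (f k) * b (f k) (e j))"
      using ij by (simp add: M_def N_def scalar_prod_def)
    also have "\<dots> = (\<Sum>t\<in>T. a (e i) t * b t (e j))" by (rule sum.reindex_bij_betw[OF f])
    finally show "(M * N) $$ (i, j) = 1\<^sub>m (card S) $$ (i, j)" using ij ab eS einj by simp
  qed (use M N in auto)
  show "card S \<le> card T" by (rule left_inverse_dim_le[OF M N MN])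
  assume eq: "card S = card T" and t: "t \<in> T" and t': "t' \<in> T"
  have NM: "N * M = 1\<^sub>m (card T)"
    using mat_mult_left_right_inverse[OF M[unfolded eq] N[unfolded eq] MN[unfolded eq]] .
  have "t \<in> f ` {0..<card T}" "t' \<in> f ` {0..<card T}"
    unfolding bij_betw_imp_surj_on[OF f] by (rule t, rule t')
  then obtain i j where ij: "i < card T" "j < card T" "t = f i" "t' = f j" by auto
  have "(N * M) $$ (i, j) = (\<Sum>k = 0..<card S. b (f i) (e k) * a (e k) (f j))"
    using ij by (simp add: M_def N_def scalar_prod_def)
  also have "\<dots> = (\<Sum>s\<in>S. b (f i) s * a s (f j))" by (rule sum.reindex_bij_betw[OF e])
  finally have "(\<Sum>s\<in>S. b t s * a s t') = 1\<^sub>m (card T) $$ (i, j)"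
    unfolding NM ij(3,4) by (rule sym)
  also have "\<dots> = of_bool (t = t')" using ij(1,2) finj[OF ij(1,2)] by (simp add: ij(3,4))
  finally show "(\<Sum>s\<in>S. b t s * a s t') = of_bool (t = t')" .
qed

lemma partition_on_finite: "finite A \<Longrightarrow> partition_on A P \<Longrightarrow> finite P"
  by (metis finite_UnionD partition_onD1)

lemma partition_subset: "partition_on A P \<Longrightarrow> p \<in> P \<Longrightarrow> p \<subseteq> A"
  using partition_onD1 by blast

lemma partition_block_eq:
  "partition_on A P \<Longrightarrow> p \<in> P \<Longrightarrow> q \<in> P \<Longrightarrow> x \<in> p \<Longrightarrow> x \<in> q \<Longrightarrow> p = q"
  by (auto simp: partition_on_def disjoint_def)

lemma partition_on_SOME: "partition_on A P \<Longrightarrow> p \<in> P \<Longrightarrow> (SOME x. x \<in> p) \<in> p"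
  by (metis partition_onD3 some_in_eq)

text \<open>Mapping each block of \<open>P\<close> to the block of \<open>Q\<close> that contains it is surjective; if the two
partitions have equally many blocks, it is injective too, so every block of \<open>Q\<close> contains a
single block of \<open>P\<close> and equals it.\<close>

lemma refines_card:
  assumes A: "finite A" and ref: "refines A P Q"
  shows "card Q \<le> card P" and "card P = card Q \<Longrightarrow> P = Q"
proof -
  have P: "partition_on A P" and Q: "partition_on A Q" using ref by (auto simp: refines_def)
  note fin = partition_on_finite[OF A P]
  obtain c where c: "\<And>p. p \<in> P \<Longrightarrow> c p \<in> Q \<and> p \<subseteq> c p" using ref unfolding refines_def by metis
  have sub: "\<Union>{p \<in> P. p \<subseteq> q} = q" if "q \<in> Q" for q
    using partition_onD1[OF refines_obtains_subset[OF ref that]] by simp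
  have cq: "c p = q" if "p \<in> P" "q \<in> Q" "p \<subseteq> q" for p q
    using c[OF that(1)] that partition_onD3[OF P] partition_block_eq[OF Q, of "c p" q]
    by (metis equals0I subsetD)
  have "Q \<subseteq> c ` P"
  proof
    fix q assume q: "q \<in> Q"
    then have "q \<noteq> {}" using partition_onD3[OF Q] by blast
    then obtain p where "p \<in> P" "p \<subseteq> q" using sub[OF q] by auto
    then show "q \<in> c ` P" using cq q by blast
  qed
  then have img: "c ` P = Q" using c by blast
  then show "card Q \<le> card P" using card_image_le[OF fin, of c] by simp
  assume "card P = card Q"
  then have inj: "inj_on c P" using eq_card_imp_inj_on[OF fin, of c] img by simp
  have "c p = p" if p: "p \<in> P" for p
  proof -
    have "p' = p" if p': "p' \<in> P" "p' \<subseteq> c p" for p'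
      using cq[OF p'(1) conjunct1[OF c[OF p]] p'(2)] by (rule inj_onD[OF inj _ p'(1) p])
    then have "{p' \<in> P. p' \<subseteq> c p} = {p}" using c[OF p] p by blast
    then show ?thesis using sub[of "c p"] c[OF p] by simp
  qed
  then show "P = Q" using img by simp
qed

text \<open>Otherwise the number of blocks grows with every step, whereas a partition of \<open>A\<close> has at
most \<open>card A\<close> blocks.\<close>

lemma refining_iteration_stabilises:
  assumes A: "finite A" and P: "Inv P" "partition_on A P"
    and step: "\<And>P. Inv P \<Longrightarrow> partition_on A P \<Longrightarrow> Inv (F P) \<and> refines A (F P) P"
  shows "\<exists>n. (F ^^ (n + 1)) P = (F ^^ n) P"
proof (rule ccontr)
  assume neq: "\<nexists>n. (F ^^ (n + 1)) P = (F ^^ n) P"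
  have inv: "Inv ((F ^^ n) P) \<and> partition_on A ((F ^^ n) P)" for n
    using P step by (induction n) (auto simp: refines_def)
  have "card ((F ^^ n) P) < card ((F ^^ Suc n) P)" for n
    using refines_card[OF A conjunct2[OF step], of "(F ^^ n) P"] inv[of n] neq
    by (metis Suc_eq_plus1 comp_apply funpow.simps(2) le_neq_implies_less)
  then have "strict_mono (\<lambda>n. card ((F ^^ n) P))" by (simp add: strict_mono_Suc_iff)
  then have "Suc (card A) \<le> card ((F ^^ Suc (card A)) P)" by (rule strict_mono_imp_increasing)
  moreover have "card Q \<le> card A" if Q: "partition_on A Q" for Q
  proof -
    have "refines A ((\<lambda>x. {x}) ` A) Q"
      using Q partition_onD1[OF Q] by (auto simp: refines_def partition_on_singletons)
    from refines_card(1)[OF A this] show ?thesis by (simp add: card_image)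
  qed
  ultimately show False using inv[of "Suc (card A)"] by fastforce
qed

text \<open>\<^const>\<open>ClPt\<close> and \<^const>\<open>IrPt\<close> are both of the form \<open>Q\<close>: the joint fibres of a family of functions. The
last two statements give what is needed to compare \<open>Q\<close> with another partition \<open>P\<close>: all functions of the
family are constant on the blocks of \<open>P\<close>, or the family separates the blocks of \<open>P\<close>.\<close>

lemma fibre_partition:
  fixes f :: "'i \<Rightarrow> 'x \<Rightarrow> 'y" and A :: "'x set" and I :: "'i set"
  defines "Q \<equiv> A // {(x, y). x \<in> A \<and> y \<in> A \<and> (\<forall>i\<in>I. f i x = f i y)}"
  shows "partition_on A Q"
    and "q \<in> Q \<Longrightarrow> x \<in> q \<Longrightarrow> y \<in> q \<Longrightarrow> i \<in> I \<Longrightarrow> f i x = f i y"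
    and "partition_on A P \<Longrightarrow> (\<And>p x y i. p \<in> P \<Longrightarrow> x \<in> p \<Longrightarrow> y \<in> p \<Longrightarrow> i \<in> I \<Longrightarrow> f i x = f i y) \<Longrightarrow> refines A P Q"
    and "partition_on A P \<Longrightarrow>
      (\<And>x y p. x \<in> A \<Longrightarrow> y \<in> A \<Longrightarrow> \<forall>i\<in>I. f i x = f i y \<Longrightarrow> p \<in> P \<Longrightarrow> x \<in> p \<Longrightarrow> y \<in> p) \<Longrightarrow>
      refines A Q P"
proof -
  let ?r = "{(x, y). x \<in> A \<and> y \<in> A \<and> (\<forall>i\<in>I. f i x = f i y)}"
  have "equiv A ?r" by (auto simp: equiv_def refl_on_def sym_def trans_def)
  then show part: "partition_on A Q" unfolding Q_def by (rule partition_on_quotient)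
  have fib: "q \<subseteq> A \<and> (\<forall>x\<in>q. \<forall>y\<in>A. y \<in> q \<longleftrightarrow> (\<forall>i\<in>I. f i x = f i y))" if "q \<in> Q" for q
    using that by (auto simp: Q_def quotient_def)
  then show "q \<in> Q \<Longrightarrow> x \<in> q \<Longrightarrow> y \<in> q \<Longrightarrow> i \<in> I \<Longrightarrow> f i x = f i y" by blast
  show "refines A P Q" if P: "partition_on A P"
    and const: "\<And>p x y i. p \<in> P \<Longrightarrow> x \<in> p \<Longrightarrow> y \<in> p \<Longrightarrow> i \<in> I \<Longrightarrow> f i x = f i y"
    unfolding refines_def
  proof (intro conjI ballI P part)
    fix p assume p: "p \<in> P"
    obtain x where x: "x \<in> p" using partition_on_SOME[OF P p] by blast
    then have "x \<in> A" using p partition_onD1[OF P] by blast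
    then obtain q where q: "q \<in> Q" "x \<in> q" using partition_onD1[OF part] by blast
    have "p \<subseteq> q" using fib[OF q(1)] q(2) const[OF p x] p partition_onD1[OF P] by blast
    then show "\<exists>q\<in>Q. p \<subseteq> q" using q by blast
  qed
  show "refines A Q P" if P: "partition_on A P"
    and sep: "\<And>x y p. x \<in> A \<Longrightarrow> y \<in> A \<Longrightarrow> \<forall>i\<in>I. f i x = f i y \<Longrightarrow> p \<in> P \<Longrightarrow> x \<in> p \<Longrightarrow> y \<in> p"
    unfolding refines_def
  proof (intro conjI ballI P part)
    fix q assume q: "q \<in> Q"
    obtain x where x: "x \<in> q" using partition_on_SOME[OF part q] by blast
    then have "x \<in> A" using fib[OF q] by blast
    then obtain p where p: "p \<in> P" "x \<in> p" using partition_onD1[OF P] by blast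
    have "q \<subseteq> p" using fib[OF q] x sep[of x _ p] p \<open>x \<in> A\<close> by blast
    then show "\<exists>p\<in>P. q \<subseteq> p" using p by blast
  qed
qed

section \<open>The two partition operators\<close>

lemma linear_ext_set_sum:
  assumes "finite K"
  shows "linear_ext \<chi> (set_sum K) = (\<Sum>k\<in>K. \<chi> k)"
proof -
  have lookup: "Poly_Mapping.lookup (set_sum K) g = of_bool (g \<in> K)" for g
    using assms by (simp add: set_sum_def lookup_sum lookup_single when_def of_bool_def)
  then have "Poly_Mapping.keys (set_sum K) = K" by (auto simp: in_keys_iff)
  then show ?thesis by (simp add: linear_ext_def lookup)
qed

context finite_group begin

text \<open>For a conjugacy class \<open>K\<close> this is the central character of \<open>\<chi>\<close> at the class sum of \<open>K\<close>.\<close>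

definition \<omega> :: "'a set \<Rightarrow> ('a \<Rightarrow> complex) \<Rightarrow> complex" where
  "\<omega> K \<chi> = (\<Sum>k\<in>K. \<chi> k) / \<chi> \<one>"

text \<open>The elementwise form of \<open>G\<close>-invariance.\<close>

definition conj_closed :: "'a set \<Rightarrow> bool" where
  "conj_closed K \<longleftrightarrow> K \<subseteq> carrier G \<and> (\<forall>x\<in>carrier G. \<forall>g\<in>K. x \<otimes> g \<otimes> inv x \<in> K)"

lemma G_invariant_conj_closed:
  assumes "G_invariant G K"
  shows "conj_closed K"
proof -
  obtain S where S: "S \<subseteq> conj_classes G" "K = \<Union>S" using assms by (auto simp: G_invariant_def)
  have "conj_closed C" if "C \<in> conj_classes G" for C
  proof -
    obtain h where h: "h \<in> carrier G" and C: "C = {g \<otimes> h \<otimes> inv g | g. g \<in> carrier G}"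
    proof -
      from \<open>C \<in> conj_classes G\<close> obtain h where "h \<in> carrier G"
        "C = {(\<lambda>h\<in>carrier G. g \<otimes> h \<otimes> inv g) h | g. g \<in> carrier G}"
        unfolding conj_classes_def orbits_def orbit_def by blast
      then show thesis by (intro that[of h]) simp_all
    qed
    have "x \<otimes> (g \<otimes> h \<otimes> inv g) \<otimes> inv x = (x \<otimes> g) \<otimes> h \<otimes> inv (x \<otimes> g)"
      if "x \<in> carrier G" "g \<in> carrier G" for x g
      using that h by (simp add: inv_mult_group m_assoc)
    then show ?thesis using h by (fastforce simp: conj_closed_def C)
  qed
  then show ?thesis using S by (fastforce simp: conj_closed_def)
qed

lemma conj_closed_iff:
  assumes "conj_closed K" "x \<in> carrier G" "g \<in> carrier G"
  shows "x \<otimes> g \<otimes> inv x \<in> K \<longleftrightarrow> g \<in> K"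
proof
  assume "x \<otimes> g \<otimes> inv x \<in> K"
  then have "inv x \<otimes> (x \<otimes> g \<otimes> inv x) \<otimes> inv (inv x) \<in> K"
    using assms(1) inv_closed[OF assms(2)] unfolding conj_closed_def by blast
  also have "inv x \<otimes> (x \<otimes> g \<otimes> inv x) \<otimes> inv (inv x) = g"
    using assms by (simp add: m_assoc) (simp flip: m_assoc)
  finally show "g \<in> K" .
qed (use assms in \<open>auto simp: conj_closed_def\<close>)

lemma Irr_conj: "\<chi> \<in> Irr G \<Longrightarrow> x \<in> carrier G \<Longrightarrow> g \<in> carrier G \<Longrightarrow> \<chi> (x \<otimes> g \<otimes> inv x) = \<chi> g"
proof (erule IrrE)
  fix n \<rho> assume irr: "irreducible_representation G n \<rho>" and \<chi>: "\<chi> = character_of G \<rho>"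
    and x: "x \<in> carrier G" and g: "g \<in> carrier G"
  note \<rho> = representationD[OF irreducible_representationD(1)[OF irr]]
  note c = \<rho>(1)[OF x] \<rho>(1)[OF g] \<rho>(1)[OF inv_closed[OF x]]
  have "mat_trace (\<rho> (x \<otimes> g \<otimes> inv x)) = mat_trace ((\<rho> x * \<rho> g) * \<rho> (inv x))"
    using x g by (simp add: \<rho>(3))
  also have "\<dots> = mat_trace (\<rho> (inv x) * (\<rho> x * \<rho> g))"
    using c by (intro mat_trace_mult_comm[of _ n n]) auto
  also have "\<rho> (inv x) * (\<rho> x * \<rho> g) = \<rho> g"
    unfolding assoc_mult_mat[OF c(3,1,2), symmetric] \<rho>(5)[OF x] by (rule left_mult_one_mat[OF c(2)])
  finally show "\<chi> (x \<otimes> g \<otimes> inv x) = \<chi> g" using x g by (simp add: \<chi> character_of_def)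
qed

lemma sigma_inv:
  assumes "X \<subseteq> Irr G" "g \<in> carrier G"
  shows "sigma G X (inv g) = cnj (sigma G X g)"
proof -
  have "\<chi> \<one> * \<chi> (inv g) = cnj (\<chi> \<one> * \<chi> g)" if "\<chi> \<in> X" for \<chi>
  proof -
    have \<chi>: "\<chi> \<in> Irr G" using that assms by blast
    obtain n where "\<chi> \<one> = of_nat n" using \<chi> by (rule Irr_degree)
    then show ?thesis using Irr_inv_eq_cnj[OF \<chi> assms(2)] by simp
  qed
  then show ?thesis by (auto simp: sigma_def intro!: sum.cong)
qed

text \<open>The value of \<open>\<sigma>\<^sub>X\<close> on the block \<open>L\<close> is read off at an arbitrarily chosen element. Since
\<open>cnj (\<sigma>\<^sub>X(g)) = \<sigma>\<^sub>X(g\<inverse>)\<close>, the left-hand side is a multiple of the sum of \<open>\<chi>(g) \<sigma>\<^sub>X(g\<inverse>)\<close> over the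
whole group, to which row orthogonality applies.\<close>

lemma class_partition_inversion:
  assumes L: "partition_on (carrier G) \<L>" and X: "X \<subseteq> Irr G"
    and const: "\<And>L g h. L \<in> \<L> \<Longrightarrow> g \<in> L \<Longrightarrow> h \<in> L \<Longrightarrow> sigma G X g = sigma G X h"
    and \<chi>: "\<chi> \<in> Irr G"
  shows "(\<Sum>L\<in>\<L>. \<omega> L \<chi> * (cnj (sigma G X (SOME g. g \<in> L)) / of_nat (card (carrier G)))) = of_bool (\<chi> \<in> X)"
proof -
  let ?N = "of_nat (card (carrier G)) :: complex"
  have finX: "finite X" using X finite_Irr by (rule finite_subset)
  have "(\<Sum>L\<in>\<L>. \<omega> L \<chi> * (cnj (sigma G X (SOME g. g \<in> L)) / ?N)) =
      (\<Sum>L\<in>\<L>. \<Sum>g\<in>L. \<chi> g * sigma G X (inv g)) / (\<chi> \<one> * ?N)"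
    unfolding sum_divide_distrib
  proof (rule sum.cong[OF refl])
    fix L assume LL: "L \<in> \<L>"
    have "sigma G X (inv g) = cnj (sigma G X (SOME g. g \<in> L))" if "g \<in> L" for g
      using that LL partition_onD1[OF L] sigma_inv[OF X, of g] const[OF LL that partition_on_SOME[OF L LL]] by auto
    then show "\<omega> L \<chi> * (cnj (sigma G X (SOME g. g \<in> L)) / ?N) =
        (\<Sum>g\<in>L. \<chi> g * sigma G X (inv g) / (\<chi> \<one> * ?N))"
      by (simp add: \<omega>_def sum_divide_distrib sum_distrib_right)
  qed
  also have "(\<Sum>L\<in>\<L>. \<Sum>g\<in>L. \<chi> g * sigma G X (inv g)) = (\<Sum>g\<in>carrier G. \<chi> g * sigma G X (inv g))"
    by (rule sum.partition[OF finite_carrier L, symmetric])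
  also have "\<dots> = (\<Sum>g\<in>carrier G. \<Sum>\<psi>\<in>X. \<psi> \<one> * (\<chi> g * \<psi> (inv g)))"
    by (simp add: sigma_def sum_distrib_left mult_ac)
  also have "\<dots> = (\<Sum>\<psi>\<in>X. \<psi> \<one> * (\<Sum>g\<in>carrier G. \<chi> g * \<psi> (inv g)))"
    by (subst sum.swap) (simp add: sum_distrib_left)
  also have "\<dots> = (\<Sum>\<psi>\<in>X. if \<psi> = \<chi> then \<chi> \<one> * ?N else 0)"
    using X by (intro sum.cong refl) (auto simp: first_orthogonality[OF \<chi>])
  also have "\<dots> = of_bool (\<chi> \<in> X) * (\<chi> \<one> * ?N)" using finX by simp
  finally show ?thesis using Irr_degree_nonzero[OF \<chi>] card_carrier_nonzero by simp
qed

text \<open>The factor \<open>\<chi>(1)\<close> in \<open>\<sigma>\<^sub>X\<close> cancels the denominator of \<open>\<omega> K\<close>, and the left-hand side becomes a multiple of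
the sum of \<open>\<chi>(k) \<chi>(g\<inverse>)\<close> over all \<open>k \<in> K\<close> and all irreducible \<open>\<chi>\<close>. Column orthogonality
turns it into the number of \<open>x\<close> that conjugate \<open>g\<close> into \<open>K\<close>, which is \<open>|G|\<close> or \<open>0\<close> by invariance.\<close>

lemma character_partition_inversion:
  assumes X: "partition_on (Irr G) \<X>" and K: "conj_closed K"
    and const: "\<And>X \<chi> \<psi>. X \<in> \<X> \<Longrightarrow> \<chi> \<in> X \<Longrightarrow> \<psi> \<in> X \<Longrightarrow> \<omega> K \<chi> = \<omega> K \<psi>"
    and g: "g \<in> carrier G"
  shows "(\<Sum>X\<in>\<X>. (cnj (sigma G X g) / of_nat (card (carrier G))) * \<omega> K (SOME \<chi>. \<chi> \<in> X)) = of_bool (g \<in> K)"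
proof -
  let ?N = "of_nat (card (carrier G)) :: complex"
  have KG: "K \<subseteq> carrier G" using K by (simp add: conj_closed_def)
  then have finK: "finite K" using finite_carrier by (rule finite_subset)
  have "(\<Sum>X\<in>\<X>. (cnj (sigma G X g) / ?N) * \<omega> K (SOME \<chi>. \<chi> \<in> X)) =
      (\<Sum>X\<in>\<X>. \<Sum>\<chi>\<in>X. \<Sum>k\<in>K. \<chi> k * \<chi> (inv g)) / ?N"
    unfolding sum_divide_distrib[of _ \<X>]
  proof (rule sum.cong[OF refl])
    fix X assume XX: "X \<in> \<X>"
    have XI: "X \<subseteq> Irr G" using XX partition_onD1[OF X] by blast
    have "cnj (sigma G X g) * \<omega> K (SOME \<chi>. \<chi> \<in> X) = (\<Sum>\<chi>\<in>X. \<chi> \<one> * \<chi> (inv g) * \<omega> K (SOME \<chi>. \<chi> \<in> X))"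
      unfolding sigma_inv[OF XI g, symmetric] by (simp add: sigma_def sum_distrib_right)
    also have "\<dots> = (\<Sum>\<chi>\<in>X. \<Sum>k\<in>K. \<chi> k * \<chi> (inv g))"
    proof (rule sum.cong[OF refl])
      fix \<chi> assume \<chi>: "\<chi> \<in> X"
      have "\<chi> \<one> * \<omega> K (SOME \<chi>. \<chi> \<in> X) = (\<Sum>k\<in>K. \<chi> k)"
        using const[OF XX partition_on_SOME[OF X XX] \<chi>] Irr_degree_nonzero XI \<chi> by (auto simp: \<omega>_def)
      then have "\<chi> \<one> * \<chi> (inv g) * \<omega> K (SOME \<chi>. \<chi> \<in> X) = (\<Sum>k\<in>K. \<chi> k) * \<chi> (inv g)"
        by (metis mult.assoc mult.commute)
      then show "\<chi> \<one> * \<chi> (inv g) * \<omega> K (SOME \<chi>. \<chi> \<in> X) = (\<Sum>k\<in>K. \<chi> k * \<chi> (inv g))"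
        by (simp only: sum_distrib_right)
    qed
    finally show "(cnj (sigma G X g) / ?N) * \<omega> K (SOME \<chi>. \<chi> \<in> X) = (\<Sum>\<chi>\<in>X. \<Sum>k\<in>K. \<chi> k * \<chi> (inv g)) / ?N"
      by simp
  qed
  also have "(\<Sum>X\<in>\<X>. \<Sum>\<chi>\<in>X. \<Sum>k\<in>K. \<chi> k * \<chi> (inv g)) = (\<Sum>\<chi>\<in>Irr G. \<Sum>k\<in>K. \<chi> k * \<chi> (inv g))"
    by (rule sum.partition[OF finite_Irr X, symmetric])
  also have "\<dots> = (\<Sum>k\<in>K. \<Sum>\<chi>\<in>Irr G. \<chi> k * \<chi> (inv g))" by (rule sum.swap)
  also have "\<dots> = (\<Sum>k\<in>K. of_nat (card {x \<in> carrier G. x \<otimes> g \<otimes> inv x = k}))"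
    using KG g by (intro sum.cong refl second_orthogonality) auto
  also have "\<dots> = of_nat (card (\<Union>k\<in>K. {x \<in> carrier G. x \<otimes> g \<otimes> inv x = k}))"
    unfolding of_nat_sum[symmetric] using finK by (subst card_UN_disjoint) auto
  also have "(\<Union>k\<in>K. {x \<in> carrier G. x \<otimes> g \<otimes> inv x = k}) = (if g \<in> K then carrier G else {})"
    using conj_closed_iff[OF K _ g] by auto
  finally show ?thesis using card_carrier_nonzero by simp
qed

lemma IrPt_eq:
  assumes "\<And>K. K \<in> \<K> \<Longrightarrow> K \<subseteq> carrier G"
  shows "IrPt G \<K> = Irr G // {(\<chi>, \<psi>). \<chi> \<in> Irr G \<and> \<psi> \<in> Irr G \<and> (\<forall>K\<in>\<K>. \<omega> K \<chi> = \<omega> K \<psi>)}"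
proof -
  have "linear_ext \<chi> (set_sum K) / \<chi> \<one> = \<omega> K \<chi>" if "K \<in> \<K>" for K \<chi>
    using finite_subset[OF assms[OF that] finite_carrier] by (simp add: linear_ext_set_sum \<omega>_def)
  then show ?thesis unfolding IrPt_def by (intro arg_cong[of _ _ "(//) (Irr G)"]) auto
qed

lemmas ClPt_partition = fibre_partition(1)[where A = "carrier G" and f = "sigma G", folded ClPt_def]
lemmas ClPt_constant = fibre_partition(2)[where A = "carrier G" and f = "sigma G", folded ClPt_def]
lemmas ClPt_greatest = fibre_partition(3)[where A = "carrier G" and f = "sigma G", folded ClPt_def]
lemmas ClPt_refines = fibre_partition(4)[where A = "carrier G" and f = "sigma G", folded ClPt_def]

lemma IrPt_partition: "partition_on (carrier G) \<K> \<Longrightarrow> partition_on (Irr G) (IrPt G \<K>)"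
  and IrPt_constant: "partition_on (carrier G) \<K> \<Longrightarrow> X \<in> IrPt G \<K> \<Longrightarrow> \<chi> \<in> X \<Longrightarrow> \<psi> \<in> X \<Longrightarrow> K \<in> \<K> \<Longrightarrow> \<omega> K \<chi> = \<omega> K \<psi>"
  and IrPt_greatest: "partition_on (carrier G) \<K> \<Longrightarrow> partition_on (Irr G) \<X> \<Longrightarrow>
    (\<And>X \<chi> \<psi> K. X \<in> \<X> \<Longrightarrow> \<chi> \<in> X \<Longrightarrow> \<psi> \<in> X \<Longrightarrow> K \<in> \<K> \<Longrightarrow> \<omega> K \<chi> = \<omega> K \<psi>) \<Longrightarrow> refines (Irr G) \<X> (IrPt G \<K>)"
  and IrPt_refines: "partition_on (carrier G) \<K> \<Longrightarrow> partition_on (Irr G) \<X> \<Longrightarrow>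
    (\<And>\<chi> \<psi> X. \<chi> \<in> Irr G \<Longrightarrow> \<psi> \<in> Irr G \<Longrightarrow> \<forall>K\<in>\<K>. \<omega> K \<chi> = \<omega> K \<psi> \<Longrightarrow> X \<in> \<X> \<Longrightarrow> \<chi> \<in> X \<Longrightarrow> \<psi> \<in> X) \<Longrightarrow>
    refines (Irr G) (IrPt G \<K>) \<X>"
proof -
  assume K: "partition_on (carrier G) \<K>"
  have eq: "IrPt G \<K> = Irr G // {(\<chi>, \<psi>). \<chi> \<in> Irr G \<and> \<psi> \<in> Irr G \<and> (\<forall>K\<in>\<K>. \<omega> K \<chi> = \<omega> K \<psi>)}"
    by (rule IrPt_eq) (rule partition_subset[OF K])
  note fib = fibre_partition[where A = "Irr G" and f = \<omega> and I = \<K>, folded eq]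
  show "partition_on (Irr G) (IrPt G \<K>)" by (rule fib(1))
  show "X \<in> IrPt G \<K> \<Longrightarrow> \<chi> \<in> X \<Longrightarrow> \<psi> \<in> X \<Longrightarrow> K \<in> \<K> \<Longrightarrow> \<omega> K \<chi> = \<omega> K \<psi>" by (rule fib(2))
  show "partition_on (Irr G) \<X> \<Longrightarrow>
    (\<And>X \<chi> \<psi> K. X \<in> \<X> \<Longrightarrow> \<chi> \<in> X \<Longrightarrow> \<psi> \<in> X \<Longrightarrow> K \<in> \<K> \<Longrightarrow> \<omega> K \<chi> = \<omega> K \<psi>) \<Longrightarrow> refines (Irr G) \<X> (IrPt G \<K>)"
    by (rule fib(3))
  show "partition_on (Irr G) \<X> \<Longrightarrow>
    (\<And>\<chi> \<psi> X. \<chi> \<in> Irr G \<Longrightarrow> \<psi> \<in> Irr G \<Longrightarrow> \<forall>K\<in>\<K>. \<omega> K \<chi> = \<omega> K \<psi> \<Longrightarrow> X \<in> \<X> \<Longrightarrow> \<chi> \<in> X \<Longrightarrow> \<psi> \<in> X) \<Longrightarrow>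
    refines (Irr G) (IrPt G \<K>) \<X>"
    by (rule fib(4))
qed

lemma ClPt_conj_closed:
  assumes \<X>: "partition_on (Irr G) \<X>" and L: "L \<in> ClPt G \<X>"
  shows "conj_closed L"
  unfolding conj_closed_def
proof (intro conjI ballI)
  show LG: "L \<subseteq> carrier G" by (rule partition_subset[OF ClPt_partition L])
  fix x g assume x: "x \<in> carrier G" and gL: "g \<in> L"
  have g: "g \<in> carrier G" using gL LG by blast
  have "sigma G X (x \<otimes> g \<otimes> inv x) = sigma G X g" if "X \<in> \<X>" for X
    unfolding sigma_def using partition_subset[OF \<X> that] x g by (intro sum.cong refl) (auto simp: Irr_conj)
  moreover obtain a where "a \<in> carrier G"
    "L = {h \<in> carrier G. \<forall>X\<in>\<X>. sigma G X a = sigma G X h}"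
    using L by (auto simp: ClPt_def quotient_def)
  ultimately show "x \<otimes> g \<otimes> inv x \<in> L" using gL x g by simp
qed

text \<open>\<open>\<sigma>\<^sub>Y\<close> is the sum of the \<open>\<sigma>\<^sub>X\<close> for the blocks \<open>X\<close> contained in \<open>Y\<close>.\<close>

lemma ClPt_mono:
  assumes ref: "refines (Irr G) \<X> \<Y>"
  shows "refines (carrier G) (ClPt G \<X>) (ClPt G \<Y>)"
proof (rule ClPt_greatest[OF ClPt_partition])
  fix L g h Y assume *: "L \<in> ClPt G \<X>" "g \<in> L" "h \<in> L" and Y: "Y \<in> \<Y>"
  have sub: "partition_on Y {X \<in> \<X>. X \<subseteq> Y}" by (rule refines_obtains_subset[OF ref Y])
  have fin: "finite Y" using Y ref finite_subset[OF partition_subset finite_Irr] by (auto simp: refines_def)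
  have "sigma G Y k = (\<Sum>X\<in>{X \<in> \<X>. X \<subseteq> Y}. sigma G X k)" for k
    unfolding sigma_def by (rule sum.partition[OF fin sub])
  then show "sigma G Y g = sigma G Y h"
    using ClPt_constant[OF *] by (auto intro!: sum.cong)
qed

lemma IrPt_mono:
  assumes ref: "refines (carrier G) \<K> \<L>"
  shows "refines (Irr G) (IrPt G \<K>) (IrPt G \<L>)"
proof -
  have K: "partition_on (carrier G) \<K>" and L: "partition_on (carrier G) \<L>"
    using ref by (auto simp: refines_def)
  show ?thesis
  proof (rule IrPt_greatest[OF L IrPt_partition[OF K]])
    fix X \<chi> \<psi> M assume *: "X \<in> IrPt G \<K>" "\<chi> \<in> X" "\<psi> \<in> X" and M: "M \<in> \<L>"
    have sub: "partition_on M {B \<in> \<K>. B \<subseteq> M}" by (rule refines_obtains_subset[OF ref M])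
    have fin: "finite M" using finite_subset[OF partition_subset[OF L M]] by simp
    have "\<omega> M \<phi> = (\<Sum>B\<in>{B \<in> \<K>. B \<subseteq> M}. \<omega> B \<phi>)" for \<phi>
      unfolding \<omega>_def sum_divide_distrib[symmetric] by (subst sum.partition[OF fin sub]) simp
    then show "\<omega> M \<chi> = \<omega> M \<psi>" using IrPt_constant[OF K *] by (auto intro!: sum.cong)
  qed
qed

text \<open>The second inversion formula writes the indicator function of a block of \<open>\<K>\<close> as a combination of
the functions \<open>cnj \<circ> \<sigma>\<^sub>X\<close>.\<close>

lemma ClPt_IrPt_refines:
  assumes K: "partition_on (carrier G) \<K>" and conj: "\<And>K. K \<in> \<K> \<Longrightarrow> conj_closed K"
  shows "refines (carrier G) (ClPt G (IrPt G \<K>)) \<K>"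
proof (rule ClPt_refines[OF K])
  fix g h M assume g: "g \<in> carrier G" and h: "h \<in> carrier G" and M: "M \<in> \<K>" and gM: "g \<in> M"
    and eq: "\<forall>X\<in>IrPt G \<K>. sigma G X g = sigma G X h"
  have inversion: "of_bool (k \<in> M) =
      (\<Sum>X\<in>IrPt G \<K>. (cnj (sigma G X k) / of_nat (card (carrier G))) * \<omega> M (SOME \<chi>. \<chi> \<in> X))"
    if "k \<in> carrier G" for k
    by (rule character_partition_inversion[OF IrPt_partition[OF K] conj[OF M] _ that, symmetric])
      (rule IrPt_constant[OF K _ _ _ M])
  have "of_bool (g \<in> M) = (of_bool (h \<in> M) :: complex)"
    unfolding inversion[OF g] inversion[OF h] using eq by (intro sum.cong refl) simp
  then show "h \<in> M" using gM by simp
qed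

text \<open>The first inversion formula writes the indicator function of a block of \<open>\<X>\<close> as a combination of
the functions \<open>\<omega> L\<close>.\<close>

lemma IrPt_ClPt_refines:
  assumes X: "partition_on (Irr G) \<X>"
  shows "refines (Irr G) (IrPt G (ClPt G \<X>)) \<X>"
proof (rule IrPt_refines[OF ClPt_partition X])
  fix \<chi> \<psi> Y assume \<chi>: "\<chi> \<in> Irr G" and \<psi>: "\<psi> \<in> Irr G" and Y: "Y \<in> \<X>" and \<chi>Y: "\<chi> \<in> Y"
    and eq: "\<forall>K\<in>ClPt G \<X>. \<omega> K \<chi> = \<omega> K \<psi>"
  have inversion: "of_bool (\<phi> \<in> Y) =
      (\<Sum>L\<in>ClPt G \<X>. \<omega> L \<phi> * (cnj (sigma G Y (SOME g. g \<in> L)) / of_nat (card (carrier G))))"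
    if "\<phi> \<in> Irr G" for \<phi>
    by (rule class_partition_inversion[OF ClPt_partition partition_subset[OF X Y] _ that, symmetric])
      (rule ClPt_constant[OF _ _ _ Y])
  have "of_bool (\<chi> \<in> Y) = (of_bool (\<psi> \<in> Y) :: complex)"
    unfolding inversion[OF \<chi>] inversion[OF \<psi>] using eq by (intro sum.cong refl) simp
  then show "\<psi> \<in> Y" using \<chi>Y by simp
qed

section \<open>Supercharacter theories as fixed points\<close>

text \<open>Each inversion formula says that a product of the matrices \<open>a\<close> and \<open>b\<close> is an identity matrix. The
two products have the same trace, which is the number of blocks of \<open>\<X>\<close> and also that of \<open>\<K>\<close>.\<close>

lemma supercharacter_theory_if_fixed:
  assumes K: "partition_on (carrier G) \<K>" and conj: "\<And>K. K \<in> \<K> \<Longrightarrow> conj_closed K"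
    and X: "\<X> = IrPt G \<K>" and fixed: "ClPt G \<X> = \<K>"
  shows "supercharacter_theory G (\<X>, \<K>)"
proof -
  have PX: "partition_on (Irr G) \<X>" unfolding X by (rule IrPt_partition[OF K])
  have const: "sigma G X g = sigma G X h" if "X \<in> \<X>" "L \<in> \<K>" "g \<in> L" "h \<in> L" for X L g h
    by (rule ClPt_constant[of L \<X>]) (use that fixed in auto)
  have const': "\<omega> L \<chi> = \<omega> L \<psi>" if "X \<in> \<X>" "L \<in> \<K>" "\<chi> \<in> X" "\<psi> \<in> X" for X L \<chi> \<psi>
    using IrPt_constant[OF K] that X by blast
  define a where "a X L = \<omega> L (SOME \<chi>. \<chi> \<in> X)" for X L
  define b where "b L X = cnj (sigma G X (SOME g. g \<in> L)) / of_nat (card (carrier G))" for L X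
  have ab: "(\<Sum>L\<in>\<K>. a X L * b L X) = 1" if X: "X \<in> \<X>" for X
  proof -
    have rep: "(SOME \<chi>. \<chi> \<in> X) \<in> X" by (rule partition_on_SOME[OF PX X])
    have "(\<Sum>L\<in>\<K>. a X L * b L X) = of_bool ((SOME \<chi>. \<chi> \<in> X) \<in> X)"
      unfolding a_def b_def
    proof (rule class_partition_inversion[OF K partition_subset[OF PX X]])
      show "(SOME \<chi>. \<chi> \<in> X) \<in> Irr G" using rep partition_subset[OF PX X] by blast
    qed (rule const[OF X])
    then show ?thesis using rep by simp
  qed
  have ba: "(\<Sum>X\<in>\<X>. b L X * a X L) = 1" if L: "L \<in> \<K>" for L
  proof -
    have rep: "(SOME g. g \<in> L) \<in> L" by (rule partition_on_SOME[OF K L])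
    have "(\<Sum>X\<in>\<X>. b L X * a X L) = of_bool ((SOME g. g \<in> L) \<in> L)"
      unfolding a_def b_def
    proof (rule character_partition_inversion[OF PX conj[OF L]])
      show "(SOME g. g \<in> L) \<in> carrier G" using rep partition_subset[OF K L] by blast
    qed (rule const'[OF _ L])
    then show ?thesis using rep by simp
  qed
  have "of_nat (card \<X>) = (\<Sum>X\<in>\<X>. \<Sum>L\<in>\<K>. a X L * b L X)" by (simp add: ab)
  also have "\<dots> = (\<Sum>L\<in>\<K>. \<Sum>X\<in>\<X>. b L X * a X L)" by (subst sum.swap) (simp add: mult.commute)
  also have "\<dots> = of_nat (card \<K>)" by (simp add: ba)
  finally have "card \<X> = card \<K>" using of_nat_eq_iff by blast
  then show ?thesis using K PX const unfolding supercharacter_theory_def by blast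
qed

text \<open>The first inversion formula says \<open>a * b = 1\<close> for every class partition \<open>\<M>\<close> that refines
\<open>C \<Y>\<close>. For \<open>\<M> = C \<Y>\<close> it bounds the number of blocks, which yields \<open>C \<Y> = \<L>\<close>. For \<open>\<M> = \<L>\<close> the
matrices are square, so \<open>b * a = 1\<close> as well.\<close>

lemma supercharacter_theory_determined:
  assumes "supercharacter_theory G (\<Y>, \<L>)"
  shows "ClPt G \<Y> = \<L>" and "IrPt G \<L> = \<Y>"
proof -
  have Y: "partition_on (Irr G) \<Y>" and L: "partition_on (carrier G) \<L>" and card: "card \<Y> = card \<L>"
    and const: "\<And>X L g h. X \<in> \<Y> \<Longrightarrow> L \<in> \<L> \<Longrightarrow> g \<in> L \<Longrightarrow> h \<in> L \<Longrightarrow> sigma G X g = sigma G X h"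
    using assms unfolding supercharacter_theory_def case_prod_conv by blast+
  have ref: "refines (carrier G) \<L> (ClPt G \<Y>)" by (rule ClPt_greatest[OF L]) (rule const)
  define a where "a X M = \<omega> M (SOME \<chi>. \<chi> \<in> X)" for X M
  define b where "b M X = cnj (sigma G X (SOME g. g \<in> M)) / of_nat (card (carrier G))" for M X
  have inv: "(\<Sum>M\<in>\<M>. \<omega> M \<chi> * b M X) = of_bool (\<chi> \<in> X)"
    if \<M>: "refines (carrier G) \<M> (ClPt G \<Y>)" and \<chi>: "\<chi> \<in> Irr G" and X: "X \<in> \<Y>" for \<M> \<chi> X
    unfolding b_def
  proof (rule class_partition_inversion[OF _ partition_subset[OF Y X] _ \<chi>])
    show "partition_on (carrier G) \<M>" using \<M> unfolding refines_def by blast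
    fix M g h assume M: "M \<in> \<M>" and gh: "g \<in> M" "h \<in> M"
    obtain N where N: "N \<in> ClPt G \<Y>" "M \<subseteq> N" using \<M> M unfolding refines_def by blast
    show "sigma G X g = sigma G X h"
      by (rule ClPt_constant[OF N(1) subsetD[OF N(2) gh(1)] subsetD[OF N(2) gh(2)] X])
  qed
  have rep: "(SOME \<chi>. \<chi> \<in> X) \<in> X" "(SOME \<chi>. \<chi> \<in> X) \<in> Irr G" if "X \<in> \<Y>" for X
    using partition_on_SOME[OF Y that] partition_subset[OF Y that] by blast+
  have ab: "(\<Sum>M\<in>\<M>. a X M * b M X') = of_bool (X = X')"
    if \<M>: "refines (carrier G) \<M> (ClPt G \<Y>)" and X: "X \<in> \<Y>" "X' \<in> \<Y>" for \<M> X X'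
  proof -
    have "(SOME \<chi>. \<chi> \<in> X) \<in> X' \<longleftrightarrow> X = X'"
      using rep(1)[OF X(1)] partition_block_eq[OF Y X rep(1)[OF X(1)]] by blast
    then show ?thesis unfolding a_def inv[OF \<M> rep(2)[OF X(1)] X(2)] by simp
  qed
  have fin: "finite \<Y>" "finite \<L>" "finite (ClPt G \<Y>)"
    using partition_on_finite[OF finite_Irr Y] partition_on_finite[OF finite_carrier L]
      partition_on_finite[OF finite_carrier ClPt_partition] by auto
  have "card \<Y> \<le> card (ClPt G \<Y>)"
    by (rule card_le_if_left_inverse(1)[OF fin(1,3)]) (rule ab[OF refines_refl[OF ClPt_partition]])
  then have "card \<L> = card (ClPt G \<Y>)" using refines_card(1)[OF finite_carrier ref] card by simp
  then show C: "ClPt G \<Y> = \<L>" using refines_card(2)[OF finite_carrier ref] by simp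
  have ba: "(\<Sum>X\<in>\<Y>. b M X * a X M') = of_bool (M = M')" if "M \<in> \<L>" "M' \<in> \<L>" for M M'
    by (rule card_le_if_left_inverse(2)[OF fin(1,2) _ card that]) (rule ab[OF ref])
  \<comment> \<open>Insert \<open>b * a = 1\<close> into \<open>\<omega> M' \<chi>\<close>: the value depends only on the block of \<open>\<chi>\<close>.\<close>
  have expand: "\<omega> M' \<chi> = (\<Sum>X\<in>\<Y>. of_bool (\<chi> \<in> X) * a X M')" if \<chi>: "\<chi> \<in> Irr G" and M': "M' \<in> \<L>" for \<chi> M'
  proof -
    have "\<omega> M' \<chi> = (\<Sum>M\<in>\<L>. \<omega> M \<chi> * of_bool (M = M'))"
      using M' fin(2) by simp
    also have "\<dots> = (\<Sum>M\<in>\<L>. \<Sum>X\<in>\<Y>. \<omega> M \<chi> * b M X * a X M')"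
      using ba M' by (intro sum.cong refl) (simp add: mult.assoc flip: sum_distrib_left)
    also have "\<dots> = (\<Sum>X\<in>\<Y>. (\<Sum>M\<in>\<L>. \<omega> M \<chi> * b M X) * a X M')"
      by (subst sum.swap) (simp add: sum_distrib_right)
    also have "\<dots> = (\<Sum>X\<in>\<Y>. of_bool (\<chi> \<in> X) * a X M')"
      by (intro sum.cong refl) (simp add: inv[OF ref \<chi>])
    finally show ?thesis .
  qed
  have "refines (Irr G) \<Y> (IrPt G \<L>)"
  proof (rule IrPt_greatest[OF L Y])
    fix X \<chi> \<psi> M assume X: "X \<in> \<Y>" "\<chi> \<in> X" "\<psi> \<in> X" and M: "M \<in> \<L>"
    have "\<chi> \<in> X' \<longleftrightarrow> \<psi> \<in> X'" if "X' \<in> \<Y>" for X' using partition_block_eq[OF Y X(1) that] X by blast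
    moreover have "\<chi> \<in> Irr G" "\<psi> \<in> Irr G" using partition_subset[OF Y X(1)] X by auto
    ultimately show "\<omega> M \<chi> = \<omega> M \<psi>" using M by (simp add: expand)
  qed
  with IrPt_ClPt_refines[OF Y, unfolded C] show "IrPt G \<L> = \<Y>" by (rule refines_asym)
qed

text \<open>Uniqueness: two coarsest theories refine each other, so they have the same character
partition, and by \<open>supercharacter_theory_determined\<close> this determines the class partition.\<close>

lemma is_the_coarsestI:
  assumes T: "supercharacter_theory G T" "P T"
    and max: "\<And>S. supercharacter_theory G S \<Longrightarrow> P S \<Longrightarrow> refines (Irr G) (fst S) (fst T)"
  shows "is_the_coarsest G P T"
proof -
  have C: "coarser_than_all_others G P T"
    unfolding coarser_than_all_others_def coarser_def using T max by blast
  have "S = T" if S: "coarser_than_all_others G P S" for S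
  proof (rule ccontr)
    assume ne: "S \<noteq> T"
    have sS: "supercharacter_theory G S" "P S" using S unfolding coarser_than_all_others_def by blast+
    have "refines (Irr G) (fst T) (fst S)"
      using S T ne unfolding coarser_than_all_others_def coarser_def by blast
    with max[OF sS] have "fst S = fst T" by (rule refines_asym)
    moreover have "snd S = ClPt G (fst S)" "snd T = ClPt G (fst T)"
      using supercharacter_theory_determined(1)[of "fst S" "snd S"]
        supercharacter_theory_determined(1)[of "fst T" "snd T"] sS(1) T(1) by simp_all
    ultimately show False using ne by (simp add: prod_eq_iff)
  qed
  with C show ?thesis unfolding is_the_coarsest_def by blast
qed

text \<open>A theory \<open>(\<Y>, \<L>)\<close> with \<open>\<L>\<close> finer than \<open>\<K>\<close> is a fixed point of the monotone iteration, so \<open>\<L>\<close> stays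
finer than every iterate. Invariance of the blocks is carried along because
\<open>C (I \<K>)\<close> refines \<open>\<K>\<close> only for invariant \<open>\<K>\<close>.\<close>

lemma class_partition_iteration:
  assumes K: "partition_on (carrier G) \<K>" and inv: "\<forall>K\<in>\<K>. G_invariant G K"
  shows "\<exists>n. ((ClPt G \<circ> IrPt G) ^^ (n + 1)) \<K> = ((ClPt G \<circ> IrPt G) ^^ n) \<K>"
    and "((ClPt G \<circ> IrPt G) ^^ (n + 1)) \<K> = ((ClPt G \<circ> IrPt G) ^^ n) \<K> \<Longrightarrow>
      is_the_coarsest G (\<lambda>(\<Y>, \<L>). refines (carrier G) \<L> \<K>)
        (IrPt G (((ClPt G \<circ> IrPt G) ^^ n) \<K>), ((ClPt G \<circ> IrPt G) ^^ n) \<K>)"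
proof -
  let ?F = "ClPt G \<circ> IrPt G"
  have conj: "\<forall>K\<in>\<K>. conj_closed K" using inv G_invariant_conj_closed by blast
  have step: "(\<forall>L\<in>?F \<L>. conj_closed L) \<and> refines (carrier G) (?F \<L>) \<L>"
    if "\<forall>L\<in>\<L>. conj_closed L" "partition_on (carrier G) \<L>" for \<L>
    using ClPt_conj_closed[OF IrPt_partition[OF that(2)]] ClPt_IrPt_refines[OF that(2)] that(1) by auto
  show "\<exists>n. (?F ^^ (n + 1)) \<K> = (?F ^^ n) \<K>"
    by (rule refining_iteration_stabilises[where Inv = "\<lambda>\<L>. \<forall>L\<in>\<L>. conj_closed L", OF finite_carrier conj K step])
  have iter: "(\<forall>L\<in>(?F ^^ m) \<K>. conj_closed L) \<and> refines (carrier G) ((?F ^^ m) \<K>) \<K>" for m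
  proof (induction m)
    case (Suc m)
    then have part: "partition_on (carrier G) ((?F ^^ m) \<K>)" unfolding refines_def by blast
    have iterate: "(?F ^^ Suc m) \<K> = ?F ((?F ^^ m) \<K>)" by simp
    show ?case unfolding iterate using step[OF _ part] Suc.IH by (blast intro: refines_trans)
  qed (use conj K in \<open>simp add: refines_refl\<close>)
  assume fixed: "(?F ^^ (n + 1)) \<K> = (?F ^^ n) \<K>"
  have part: "partition_on (carrier G) ((?F ^^ n) \<K>)" using iter[of n] unfolding refines_def by blast
  have fixed': "ClPt G (IrPt G ((?F ^^ n) \<K>)) = (?F ^^ n) \<K>"
    using fixed unfolding Suc_eq_plus1[symmetric] funpow.simps(2) comp_apply .
  show "is_the_coarsest G (\<lambda>(\<Y>, \<L>). refines (carrier G) \<L> \<K>) (IrPt G ((?F ^^ n) \<K>), (?F ^^ n) \<K>)"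
  proof (rule is_the_coarsestI)
    show "supercharacter_theory G (IrPt G ((?F ^^ n) \<K>), (?F ^^ n) \<K>)"
      by (rule supercharacter_theory_if_fixed[OF part _ refl fixed']) (use iter[of n] in blast)
    show "case (IrPt G ((?F ^^ n) \<K>), (?F ^^ n) \<K>) of (\<Y>, \<L>) \<Rightarrow> refines (carrier G) \<L> \<K>"
      using iter by simp
    fix S assume S: "supercharacter_theory G S" "case S of (\<Y>, \<L>) \<Rightarrow> refines (carrier G) \<L> \<K>"
    obtain \<Y> \<L> where S': "S = (\<Y>, \<L>)" by fastforce
    note det = supercharacter_theory_determined[OF S(1)[unfolded S']]
    have "refines (carrier G) \<L> ((?F ^^ m) \<K>)" for m
    proof (induction m)
      case (Suc m)
      have iterate: "(?F ^^ Suc m) \<K> = ClPt G (IrPt G ((?F ^^ m) \<K>))" by simp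
      show ?case unfolding iterate using ClPt_mono[OF IrPt_mono[OF Suc]] unfolding det .
    qed (use S S' in simp)
    from IrPt_mono[OF this[of n]]
    show "refines (Irr G) (fst S) (fst (IrPt G ((?F ^^ n) \<K>), (?F ^^ n) \<K>))"
      unfolding S' fst_conv det .
  qed
qed

text \<open>As for class partitions, with the roles of \<open>I\<close> and \<open>C\<close> exchanged; the class partition
\<open>C \<X>\<close> is invariant for every \<open>\<X>\<close>.\<close>

lemma character_partition_iteration:
  assumes X: "partition_on (Irr G) \<X>"
  shows "\<exists>n. ((IrPt G \<circ> ClPt G) ^^ (n + 1)) \<X> = ((IrPt G \<circ> ClPt G) ^^ n) \<X>"
    and "((IrPt G \<circ> ClPt G) ^^ (n + 1)) \<X> = ((IrPt G \<circ> ClPt G) ^^ n) \<X> \<Longrightarrow>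
      is_the_coarsest G (\<lambda>(\<Y>, \<L>). refines (Irr G) \<Y> \<X>)
        (((IrPt G \<circ> ClPt G) ^^ n) \<X>, ClPt G (((IrPt G \<circ> ClPt G) ^^ n) \<X>))"
proof -
  let ?F = "IrPt G \<circ> ClPt G"
  have step: "refines (Irr G) (?F \<Y>) \<Y>" if "partition_on (Irr G) \<Y>" for \<Y>
    unfolding comp_apply by (rule IrPt_ClPt_refines[OF that])
  show "\<exists>n. (?F ^^ (n + 1)) \<X> = (?F ^^ n) \<X>"
    by (rule refining_iteration_stabilises[where Inv = "\<lambda>_. True", OF finite_Irr TrueI X])
      (rule conjI[OF TrueI step])
  have iter: "refines (Irr G) ((?F ^^ m) \<X>) \<X>" for m
  proof (induction m)
    case (Suc m)
    then have part: "partition_on (Irr G) ((?F ^^ m) \<X>)" unfolding refines_def by blast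
    have iterate: "(?F ^^ Suc m) \<X> = ?F ((?F ^^ m) \<X>)" by simp
    show ?case unfolding iterate using step[OF part] Suc.IH by (rule refines_trans)
  qed (use X in \<open>simp add: refines_refl\<close>)
  assume fixed: "(?F ^^ (n + 1)) \<X> = (?F ^^ n) \<X>"
  have part: "partition_on (Irr G) ((?F ^^ n) \<X>)" using iter[of n] unfolding refines_def by blast
  have fixed': "(?F ^^ n) \<X> = IrPt G (ClPt G ((?F ^^ n) \<X>))"
    using fixed[symmetric] unfolding Suc_eq_plus1[symmetric] funpow.simps(2) comp_apply .
  show "is_the_coarsest G (\<lambda>(\<Y>, \<L>). refines (Irr G) \<Y> \<X>) ((?F ^^ n) \<X>, ClPt G ((?F ^^ n) \<X>))"
  proof (rule is_the_coarsestI)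
    show "supercharacter_theory G ((?F ^^ n) \<X>, ClPt G ((?F ^^ n) \<X>))"
      by (rule supercharacter_theory_if_fixed[OF ClPt_partition ClPt_conj_closed[OF part] fixed' refl])
    show "case ((?F ^^ n) \<X>, ClPt G ((?F ^^ n) \<X>)) of (\<Y>, \<L>) \<Rightarrow> refines (Irr G) \<Y> \<X>"
      using iter by simp
    fix S assume S: "supercharacter_theory G S" "case S of (\<Y>, \<L>) \<Rightarrow> refines (Irr G) \<Y> \<X>"
    obtain \<Y> \<L> where S': "S = (\<Y>, \<L>)" by fastforce
    note det = supercharacter_theory_determined[OF S(1)[unfolded S']]
    have "refines (Irr G) \<Y> ((?F ^^ m) \<X>)" for m
    proof (induction m)
      case (Suc m)
      have iterate: "(?F ^^ Suc m) \<X> = IrPt G (ClPt G ((?F ^^ m) \<X>))" by simp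
      show ?case unfolding iterate using IrPt_mono[OF ClPt_mono[OF Suc]] unfolding det .
    qed (use S S' in simp)
    from this[of n] show "refines (Irr G) (fst S) (fst ((?F ^^ n) \<X>, ClPt G ((?F ^^ n) \<X>)))" by (simp add: S')
  qed
qed

end

theorem corollary4p1:
  fixes G :: "('a, 'b) monoid_scheme"
  assumes "group G" and "finite (carrier G)"
  defines "I \<equiv> IrPt G" and "C \<equiv> ClPt G"
  shows
    "(\<forall>\<K>. partition_on (carrier G) \<K> \<and> (\<forall>K\<in>\<K>. G_invariant G K) \<longrightarrow>
        (\<exists>n. ((C \<circ> I) ^^ (n + 1)) \<K> = ((C \<circ> I) ^^ n) \<K>) \<and>
        (\<forall>n. ((C \<circ> I) ^^ (n + 1)) \<K> = ((C \<circ> I) ^^ n) \<K> \<longrightarrow>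
           is_the_coarsest G (\<lambda>(\<Y>, \<L>). refines (carrier G) \<L> \<K>)
             (I (((C \<circ> I) ^^ n) \<K>), ((C \<circ> I) ^^ n) \<K>)))
     \<and>
     (\<forall>\<X>. partition_on (Irr G) \<X> \<longrightarrow>
        (\<exists>n. ((I \<circ> C) ^^ (n + 1)) \<X> = ((I \<circ> C) ^^ n) \<X>) \<and>
        (\<forall>n. ((I \<circ> C) ^^ (n + 1)) \<X> = ((I \<circ> C) ^^ n) \<X> \<longrightarrow>
           is_the_coarsest G (\<lambda>(\<Y>, \<L>). refines (Irr G) \<Y> \<X>)
             (((I \<circ> C) ^^ n) \<X>, C (((I \<circ> C) ^^ n) \<X>))))"
proof -
  have G: "finite_group G"
    by (rule finite_group.intro[OF assms(1) finite_group_axioms.intro[OF assms(2)]])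
  note class_iteration = finite_group.class_partition_iteration[OF G]
  note character_iteration = finite_group.character_partition_iteration[OF G]
  show ?thesis
    unfolding I_def C_def
    by (intro conjI allI impI; (elim conjE)?)
      (rule class_iteration character_iteration; assumption)+
qed

end
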